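(* Let $n\ge 1$. The Hilbert series of $EQH_n$ is $$\mathrm{Hilb}_{EQH_n}(q)=\sum_{k=0}^{\lfloor n/2\rfloor} f^{(n-k,k)}q^k,$$ where $f^{(n-k,k)}$ is the number of standard Young tableaux of shape $(n-k,k)$.
   Context: Let $R_n=\mathbb{Q}[\theta_1,\dots,\theta_n]$ be the polynomial ring in anticommuting variables over $\mathbb{Q}$ (exterior algebra): $\theta_i\theta_j=-\theta_j\theta_i$ for $i\ne j$, $\theta_i^2=0$, graded by degree. For $A=\{a_1<\cdots<a_r\}\subseteq[n]$ put $\theta_A=\theta_{a_1}\cdots\theta_{a_r}$, and $F_{1^r}=\sum_{A\subseteq[n],|A|=r}\theta_A$. Let $I_n$ be the ideal of $R_n$ generated by $F_{1^r}$, $1\le r\le n$. Operators $\partial_{\theta_i}$ on $R_n$: $\partial_{\theta_i}(\theta_A)=(-1)^{\#\{j\in A: j<i\}}\theta_{A\setminus\{i\}}$ if $i\in A$, and $0$ otherwise. The inner product on $R_n$ is $\langle p,q\rangle=\overline{p(\partial_{\theta_1},\dots,\partial_{\theta_n})}\,q(\theta_1,\dots,\theta_n)|_{\theta_1=\cdots=\theta_n=0}$, where the bar reverses the order of the factors in every monomial; the monomials $\theta_A$ are an orthonormal basis for it. Define $EQH_n=\{q\in R_n:\langle p,q\rangle=0\text{ for all }p\in I_n\}$, a graded subspace of $R_n$. The Hilbert series of a graded space $V=\bigoplus_k V_k$ is $\sum_k \dim(V_k)q^k$. *)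

theory Defs
  imports
    "HOL-Algebra.Ideal"
    "HOL-Library.Function_Algebras"
    "HOL-Library.FuncSet"
    "HOL-Computational_Algebra.Formal_Power_Series"
begin

section \<open>The exterior algebra\<close>

text \<open>
  An element is represented by its coordinates in the monomial basis: \<open>f A\<close> is the coefficient of
  \<open>\<theta>\<^sub>A\<close>, and the elements of \<open>R n\<close> are those supported on subsets of \<open>{1..n}\<close>.
  Addition is the pointwise one of \<open>HOL-Library.Function_Algebras\<close>; the pointwise product of that
  theory plays no role.
\<close>

type_synonym ext = "nat set \<Rightarrow> rat"

definition ext_scale :: "rat \<Rightarrow> ext \<Rightarrow> ext"
  where "ext_scale c f = (\<lambda>A. c * f A)"

global_interpretation ext: vector_space ext_scale
  by standard (auto simp: ext_scale_def fun_eq_iff algebra_simps)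

definition theta :: "nat set \<Rightarrow> ext"
  where "theta A = (\<lambda>B. if B = A then 1 else 0)"

text \<open>The number of transpositions needed to sort the concatenation of the sorted words \<open>A\<close>, \<open>B\<close>.\<close>

definition inversions :: "nat set \<Rightarrow> nat set \<Rightarrow> nat"
  where "inversions A B = card {(a, b). a \<in> A \<and> b \<in> B \<and> b < a}"

text \<open>
  The bilinear extension of \<open>\<theta>\<^sub>A \<theta>\<^sub>B = (-1)\<^bsup>inversions A B\<^esup> \<theta>\<^bsub>A \<union> B\<^esub>\<close> for disjoint
  \<open>A\<close>, \<open>B\<close>, and \<open>0\<close> otherwise; the lemmas \<open>theta_square\<close>, \<open>theta_anticommute\<close> and
  \<open>theta_eq_prod\<close> recover the defining presentation.
\<close>

definition ext_mult :: "ext \<Rightarrow> ext \<Rightarrow> ext"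
  where "ext_mult f g = (\<lambda>C. \<Sum>A\<in>Pow C. (- 1) ^ inversions A (C - A) * f A * g (C - A))"

definition R :: "nat \<Rightarrow> ext ring"
  where "R n = \<lparr>carrier = {f. \<forall>A. f A \<noteq> 0 \<longrightarrow> A \<subseteq> {1..n}},
                monoid.mult = ext_mult, one = theta {}, zero = 0, add = (+)\<rparr>"

definition R_deg :: "nat \<Rightarrow> nat \<Rightarrow> ext set"
  where "R_deg n k = {f \<in> carrier (R n). \<forall>A. f A \<noteq> 0 \<longrightarrow> card A = k}"

definition F :: "nat \<Rightarrow> nat \<Rightarrow> ext"
  where "F n r = (\<Sum>A | A \<subseteq> {1..n} \<and> card A = r. theta A)"

definition I :: "nat \<Rightarrow> ext set"
  where "I n = Idl\<^bsub>R n\<^esub> {F n r | r. 1 \<le> r \<and> r \<le> n}"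

section \<open>Derivatives, the inner product and the harmonics\<close>

text \<open>In coordinates; see \<open>d_theta_theta\<close> for the action on the monomial basis.\<close>

definition d_theta :: "nat \<Rightarrow> ext \<Rightarrow> ext"
  where "d_theta i f =
    (\<lambda>B. if i \<in> B then 0 else (- 1) ^ card {j \<in> B. j < i} * f (insert i B))"

text \<open>
  For \<open>A = {a\<^sub>1 < \<dots> < a\<^sub>r}\<close> this is \<open>\<partial>\<^bsub>a\<^sub>r\<^esub> \<circ> \<dots> \<circ> \<partial>\<^bsub>a\<^sub>1\<^esub>\<close>:
  the word of \<open>A\<close> with its factors reversed.
\<close>

definition rev_monomial_deriv :: "nat set \<Rightarrow> ext \<Rightarrow> ext"
  where "rev_monomial_deriv A = foldr d_theta (rev (sorted_list_of_set A))"

text \<open>Setting all \<open>\<theta>\<^sub>i\<close> to \<open>0\<close> means taking the coefficient of \<open>\<theta>\<^bsub>{}\<^esub> = 1\<close>.\<close>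

definition ext_inner :: "nat \<Rightarrow> ext \<Rightarrow> ext \<Rightarrow> rat"
  where "ext_inner n p q = (\<Sum>A\<in>Pow {1..n}. ext_scale (p A) (rev_monomial_deriv A q)) {}"

definition EQH :: "nat \<Rightarrow> ext set"
  where "EQH n = {q \<in> carrier (R n). \<forall>p \<in> I n. ext_inner n p q = 0}"

definition hilbert_series :: "nat \<Rightarrow> ext set \<Rightarrow> int fps"
  where "hilbert_series n V = Abs_fps (\<lambda>k. int (ext.dim (V \<inter> R_deg n k)))"

section \<open>Standard Young tableaux\<close>

definition cells :: "nat list \<Rightarrow> (nat \<times> nat) set"
  where "cells sh = {(i, j). i < length sh \<and> j < sh ! i}"

definition SYT :: "nat list \<Rightarrow> (nat \<times> nat \<Rightarrow> nat) set"
  where "SYT sh = {T \<in> extensional (cells sh).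
     bij_betw T (cells sh) {1..sum_list sh} \<and>
     (\<forall>i j j'. (i, j) \<in> cells sh \<and> (i, j') \<in> cells sh \<and> j < j' \<longrightarrow> T (i, j) < T (i, j')) \<and>
     (\<forall>i i' j. (i, j) \<in> cells sh \<and> (i', j) \<in> cells sh \<and> i < i' \<longrightarrow> T (i, j) < T (i', j))}"

definition num_SYT :: "nat list \<Rightarrow> nat"
  where "num_SYT sh = card (SYT sh)"

section \<open>Consistency of the definitions\<close>

lemma theta_in_R: "A \<subseteq> {1..n} \<Longrightarrow> theta A \<in> carrier (R n)"
  by (auto simp: theta_def R_def)

lemma inversions_empty [simp]: "inversions {} B = 0" "inversions A {} = 0"
  by (auto simp: inversions_def)

lemma finite_inversions:
  assumes "finite A" "finite B"
  shows "finite {(a, b). a \<in> A \<and> b \<in> B \<and> b < (a::nat)}"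
  by (rule finite_subset[of _ "A \<times> B"]) (use assms in auto)

lemma inversions_Un_left:
  assumes "finite A" "finite B" "finite C" "A \<inter> B = {}"
  shows "inversions (A \<union> B) C = inversions A C + inversions B C"
proof -
  have "{(a, b). a \<in> A \<union> B \<and> b \<in> C \<and> b < a} =
      {(a, b). a \<in> A \<and> b \<in> C \<and> b < a} \<union> {(a, b). a \<in> B \<and> b \<in> C \<and> b < a}"
    by auto
  then show ?thesis
    unfolding inversions_def
    using assms finite_inversions by (subst card_Un_disjoint[symmetric]) auto
qed

lemma inversions_Un_right:
  assumes "finite A" "finite B" "finite C" "B \<inter> C = {}"
  shows "inversions A (B \<union> C) = inversions A B + inversions A C"
proof -
  have "{(a, b). a \<in> A \<and> b \<in> B \<union> C \<and> b < a} =
      {(a, b). a \<in> A \<and> b \<in> B \<and> b < a} \<union> {(a, b). a \<in> A \<and> b \<in> C \<and> b < a}"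
    by auto
  then show ?thesis
    unfolding inversions_def
    using assms finite_inversions by (subst card_Un_disjoint[symmetric]) auto
qed

lemma ext_mult_infinite: "infinite C \<Longrightarrow> ext_mult f g C = 0"
  by (simp add: ext_mult_def)

lemma ext_mult_assoc: "ext_mult (ext_mult f g) h = ext_mult f (ext_mult g h)"
proof
  fix C :: "nat set"
  show "ext_mult (ext_mult f g) h C = ext_mult f (ext_mult g h) C"
  proof (cases "finite C")
    case fin: True
    have fin': "finite A" if "A \<subseteq> C" for A
      using fin that by (rule rev_finite_subset)
    have "ext_mult (ext_mult f g) h C = (\<Sum>D\<in>Pow C. \<Sum>A\<in>Pow D.
        (- 1) ^ inversions D (C - D) * (- 1) ^ inversions A (D - A) * f A * g (D - A) * h (C - D))"
      by (simp add: ext_mult_def sum_distrib_left sum_distrib_right mult_ac)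
    also have "\<dots> = (\<Sum>(D, A)\<in>Sigma (Pow C) Pow.
        (- 1) ^ inversions D (C - D) * (- 1) ^ inversions A (D - A) * f A * g (D - A) * h (C - D))"
      by (subst sum.Sigma) (use fin fin' in auto)
    also have "\<dots> = (\<Sum>(A, B)\<in>Sigma (Pow C) (\<lambda>A. Pow (C - A)).
        (- 1) ^ inversions A (C - A) * (- 1) ^ inversions B (C - A - B) * f A * g B * h (C - A - B))"
    proof (rule sum.reindex_bij_witness[where i = "\<lambda>(A, B). (A \<union> B, A)"
          and j = "\<lambda>(D, A). (A, D - A)"], goal_cases)
      case (5 x)
      obtain D A where x: "x = (D, A)" by force
      with 5 have sub: "A \<subseteq> D" "D \<subseteq> C" by auto
      have "inversions (A \<union> (D - A)) (C - D) = inversions A (C - D) + inversions (D - A) (C - D)"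
        by (rule inversions_Un_left) (use sub fin' in auto)
      moreover have "inversions A ((D - A) \<union> (C - D)) = inversions A (D - A) + inversions A (C - D)"
        by (rule inversions_Un_right) (use sub fin' in auto)
      moreover have "A \<union> (D - A) = D" "(D - A) \<union> (C - D) = C - A" "C - A - (D - A) = C - D"
        using sub by auto
      ultimately show ?case
        by (simp add: x power_add)
    qed auto
    also have "\<dots> = (\<Sum>A\<in>Pow C. \<Sum>B\<in>Pow (C - A).
        (- 1) ^ inversions A (C - A) * (- 1) ^ inversions B (C - A - B) * f A * g B * h (C - A - B))"
      by (subst sum.Sigma) (use fin fin' in auto)
    also have "\<dots> = ext_mult f (ext_mult g h) C"
      by (simp add: ext_mult_def sum_distrib_left mult_ac)
    finally show ?thesis .
  qed (simp add: ext_mult_infinite)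
qed

lemma ext_mult_add_left: "ext_mult (f + g) h = ext_mult f h + ext_mult g h"
  by (auto simp: ext_mult_def fun_eq_iff algebra_simps sum.distrib)

lemma ext_mult_add_right: "ext_mult f (g + h) = ext_mult f g + ext_mult f h"
  by (auto simp: ext_mult_def fun_eq_iff algebra_simps sum.distrib)

lemma ext_mult_in_R:
  assumes "f \<in> carrier (R n)" "g \<in> carrier (R n)"
  shows "ext_mult f g \<in> carrier (R n)"
proof -
  have "C \<subseteq> {1..n}" if "ext_mult f g C \<noteq> 0" for C
  proof -
    have "\<exists>A\<in>Pow C. (- 1) ^ inversions A (C - A) * f A * g (C - A) \<noteq> 0"
      using that unfolding ext_mult_def by (meson sum.neutral)
    then obtain A where "A \<subseteq> C" "f A \<noteq> 0" "g (C - A) \<noteq> 0"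
      by auto
    then have "A \<subseteq> {1..n}" "C - A \<subseteq> {1..n}"
      using assms by (auto simp: R_def)
    then show ?thesis by blast
  qed
  then show ?thesis by (auto simp: R_def)
qed

lemma ext_mult_one:
  assumes "f \<in> carrier (R n)"
  shows "ext_mult (theta {}) f = f" "ext_mult f (theta {}) = f"
proof -
  have inf: "f C = 0" if "infinite C" for C
    using assms that by (auto simp: R_def dest: finite_subset)
  have "ext_mult (theta {}) f C = f C" for C
  proof (cases "finite C")
    case True
    have "ext_mult (theta {}) f C = (\<Sum>A\<in>Pow C. if A = {} then f C else 0)"
      unfolding ext_mult_def theta_def by (intro sum.cong) auto
    then show ?thesis using True by simp
  qed (simp add: inf ext_mult_infinite)
  then show "ext_mult (theta {}) f = f" by blast
  have "ext_mult f (theta {}) C = f C" for C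
  proof (cases "finite C")
    case True
    have "ext_mult f (theta {}) C = (\<Sum>A\<in>Pow C. if A = C then f C else 0)"
      unfolding ext_mult_def theta_def by (intro sum.cong) auto
    then show ?thesis using True by simp
  qed (simp add: inf ext_mult_infinite)
  then show "ext_mult f (theta {}) = f" by blast
qed

lemma add_in_R:
  assumes "f \<in> carrier (R n)" "g \<in> carrier (R n)"
  shows "f + g \<in> carrier (R n)"
proof -
  have "A \<subseteq> {1..n}" if "f A + g A \<noteq> 0" for A
  proof -
    have "f A \<noteq> 0 \<or> g A \<noteq> 0" using that by auto
    then show ?thesis using assms by (auto simp: R_def)
  qed
  then show ?thesis by (auto simp: R_def)
qed

lemma ring_R: "ring (R n)"
proof (rule ringI)
  show "abelian_group (R n)"
  proof (rule abelian_groupI)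
    fix f assume f: "f \<in> carrier (R n)"
    show "f \<oplus>\<^bsub>R n\<^esub> g \<in> carrier (R n)" if "g \<in> carrier (R n)" for g
      using add_in_R[OF f that] by (simp add: R_def)
    show "\<exists>g\<in>carrier (R n). g \<oplus>\<^bsub>R n\<^esub> f = \<zero>\<^bsub>R n\<^esub>"
      by (rule bexI[of _ "- f"]) (use f in \<open>auto simp: R_def\<close>)
  qed (auto simp: R_def add_ac)
  show "monoid (R n)"
  proof (rule monoidI)
    show "\<one>\<^bsub>R n\<^esub> \<in> carrier (R n)"
      using theta_in_R[of "{}" n] by (simp add: R_def)
    fix f g h
    assume f: "f \<in> carrier (R n)" and g: "g \<in> carrier (R n)"
    show "f \<otimes>\<^bsub>R n\<^esub> g \<in> carrier (R n)"
      using ext_mult_in_R[OF f g] by (simp add: R_def)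
    show "f \<otimes>\<^bsub>R n\<^esub> g \<otimes>\<^bsub>R n\<^esub> h = f \<otimes>\<^bsub>R n\<^esub> (g \<otimes>\<^bsub>R n\<^esub> h)"
      by (simp add: R_def ext_mult_assoc)
    show "\<one>\<^bsub>R n\<^esub> \<otimes>\<^bsub>R n\<^esub> f = f" "f \<otimes>\<^bsub>R n\<^esub> \<one>\<^bsub>R n\<^esub> = f"
      using ext_mult_one[OF f] by (simp_all add: R_def)
  qed
qed (auto simp: R_def ext_mult_add_left ext_mult_add_right)

lemma ext_mult_theta:
  assumes "finite A" "finite B"
  shows "ext_mult (theta A) (theta B) =
    (if A \<inter> B = {} then ext_scale ((- 1) ^ inversions A B) (theta (A \<union> B)) else 0)"
proof
  fix C
  let ?r = "if A \<inter> B = {} then ext_scale ((- 1) ^ inversions A B) (theta (A \<union> B)) else 0"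
  have "ext_mult (theta A) (theta B) C =
      (\<Sum>D\<in>Pow C. if D = A then (if C - A = B then (- 1) ^ inversions A B else 0) else 0)"
    unfolding ext_mult_def by (intro sum.cong) (auto simp: theta_def)
  also have "\<dots> = (if finite C \<and> A \<subseteq> C \<and> C - A = B then (- 1) ^ inversions A B else 0)"
  proof (cases "finite C")
    case True
    then show ?thesis by (subst sum.delta) auto
  next
    case False
    then show ?thesis by (subst sum.infinite) auto
  qed
  also have "\<dots> = ?r C"
    using assms by (auto simp: ext_scale_def theta_def)
  finally show "ext_mult (theta A) (theta B) C = ?r C" .
qed

lemma theta_square: "ext_mult (theta {i}) (theta {i}) = 0"
  by (simp add: ext_mult_theta)

lemma theta_anticommute:
  assumes "i \<noteq> j"
  shows "ext_mult (theta {i}) (theta {j}) = - ext_mult (theta {j}) (theta {i})"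
proof -
  have *: "inversions {a} {b} = (if b < a then 1 else 0)" for a b
  proof -
    have "{(x, y). x \<in> {a} \<and> y \<in> {b} \<and> y < x} = (if b < a then {(a, b)} else {})"
      by auto
    then show ?thesis by (simp add: inversions_def)
  qed
  show ?thesis
    using assms by (cases "i < j") (auto simp: ext_mult_theta * ext_scale_def fun_eq_iff insert_commute)
qed

lemma theta_eq_prod:
  assumes "finite A"
  shows "theta A = foldr (\<lambda>a. ext_mult (theta {a})) (sorted_list_of_set A) (theta {})"
  using assms
proof (induction rule: finite_remove_induct)
  case (remove A)
  let ?m = "Min A"
  have m: "?m \<in> A" using remove by simp
  have "{(a, b). a \<in> {?m} \<and> b \<in> A - {?m} \<and> b < a} = {}"
    using remove by (auto simp: not_less)
  then have "inversions {?m} (A - {?m}) = 0"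
    unfolding inversions_def by (metis card.empty)
  moreover have "sorted_list_of_set A = ?m # sorted_list_of_set (A - {?m})"
    using remove by (simp add: sorted_list_of_set_nonempty)
  ultimately show ?case
    using m remove.hyps
    by (simp add: ext_mult_theta ext_scale_def insert_absorb flip: remove.IH[OF m])
qed simp

lemma d_theta_theta:
  "d_theta i (theta A) =
    (if i \<in> A then ext_scale ((- 1) ^ card {j \<in> A. j < i}) (theta (A - {i})) else 0)"
proof -
  have "{j \<in> A - {i}. j < i} = {j \<in> A. j < i}" by auto
  then show ?thesis
    by (auto simp: d_theta_def theta_def ext_scale_def fun_eq_iff)
qed

lemma d_theta_add: "d_theta i (f + g) = d_theta i f + d_theta i g"
  and d_theta_scale: "d_theta i (ext_scale c f) = ext_scale c (d_theta i f)"
  by (auto simp: d_theta_def ext_scale_def fun_eq_iff algebra_simps)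

lemma rev_monomial_deriv_coeff:
  assumes "finite A"
  shows "rev_monomial_deriv A f {} = f A"
proof -
  have "fold d_theta xs f B = f (set xs \<union> B)"
    if "sorted_wrt (<) xs" "\<forall>x\<in>set xs. \<forall>b\<in>B. x < b" for xs B
    using that
  proof (induction xs arbitrary: f)
    case (Cons x xs)
    have *: "{j \<in> set xs \<union> B. j < x} = {}" "x \<notin> set xs \<union> B"
      using Cons.prems by (auto dest: less_asym)
    have "fold d_theta (x # xs) f B = d_theta x f (set xs \<union> B)"
      using Cons by simp
    also have "\<dots> = f (set (x # xs) \<union> B)"
      unfolding d_theta_def *(1) using *(2) by simp
    finally show ?case .
  qed simp
  from this[of "sorted_list_of_set A" "{}"] show ?thesis
    using assms by (simp add: rev_monomial_deriv_def foldr_conv_fold)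
qed

lemma ext_inner_eq: "ext_inner n p q = (\<Sum>A\<in>Pow {1..n}. p A * q A)"
proof -
  have *: "sum h X {} = (\<Sum>x\<in>X. h x {})" for h :: "nat set \<Rightarrow> ext" and X
    by (induction X rule: infinite_finite_induct) auto
  show ?thesis
    unfolding ext_inner_def *
    by (intro sum.cong) (auto simp: ext_scale_def rev_monomial_deriv_coeff dest: finite_subset)
qed

lemma theta_orthonormal:
  assumes "A \<subseteq> {1..n}" "B \<subseteq> {1..n}"
  shows "ext_inner n (theta A) (theta B) = (if A = B then 1 else 0)"
proof -
  have "ext_inner n (theta A) (theta B) = (\<Sum>C\<in>Pow {1..n}. if C = A then (if A = B then 1 else 0) else 0)"
    unfolding ext_inner_eq by (intro sum.cong) (auto simp: theta_def)
  then show ?thesis using assms by simp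
qed

definition component :: "nat \<Rightarrow> ext \<Rightarrow> ext"
  where "component k f = (\<lambda>A. if card A = k then f A else 0)"

lemma component_in_R: "f \<in> carrier (R n) \<Longrightarrow> component k f \<in> carrier (R n)"
  by (auto simp: component_def R_def)

lemma component_add: "component k (f + g) = component k f + component k g"
  by (auto simp: component_def fun_eq_iff)

lemma component_theta: "component k (theta A) = (if card A = k then theta A else 0)"
  by (auto simp: component_def theta_def fun_eq_iff)

lemma component_sum: "component k (sum h X) = (\<Sum>x\<in>X. component k (h x))"
proof -
  have "component k 0 = 0" by (auto simp: component_def fun_eq_iff)
  then show ?thesis
    by (induction X rule: infinite_finite_induct) (simp_all add: component_add)
qed

lemma component_F: "component k (F n r) = (if k = r then F n r else 0)"
proof -
  have "component k (F n r) = (\<Sum>A | A \<subseteq> {1..n} \<and> card A = r. if k = r then theta A else 0)"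
    unfolding F_def component_sum by (intro sum.cong) (auto simp: component_theta)
  then show ?thesis by (simp add: F_def)
qed

lemma sum_ext_apply: "sum h X A = (\<Sum>x\<in>X. h x A)" for h :: "'b \<Rightarrow> ext"
  by (induction X rule: infinite_finite_induct) auto

lemma component_mult:
  "component k (ext_mult f g) = (\<Sum>i\<le>k. ext_mult (component i f) (component (k - i) g))"
proof
  fix C
  show "component k (ext_mult f g) C = (\<Sum>i\<le>k. ext_mult (component i f) (component (k - i) g)) C"
  proof (cases "finite C")
    case fin: True
    have "(\<Sum>i\<le>k. ext_mult (component i f) (component (k - i) g)) C =
        (\<Sum>A\<in>Pow C. \<Sum>i\<le>k. (- 1) ^ inversions A (C - A) *
          component i f A * component (k - i) g (C - A))"
      unfolding sum_ext_apply ext_mult_def by (rule sum.swap)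
    also have "\<dots> = (\<Sum>A\<in>Pow C. if card C = k then (- 1) ^ inversions A (C - A) * f A * g (C - A) else 0)"
    proof (rule sum.cong)
      fix A assume "A \<in> Pow C"
      then have A: "A \<subseteq> C" by simp
      have c: "card (C - A) = card C - card A" "card A \<le> card C"
        using A fin by (auto simp: card_Diff_subset finite_subset card_mono)
      have "(\<Sum>i\<le>k. (- 1) ^ inversions A (C - A) * component i f A * component (k - i) g (C - A)) =
          (\<Sum>i\<le>k. if i = card A then (if card C = k then
             (- 1) ^ inversions A (C - A) * f A * g (C - A) else 0) else 0)"
        using c by (intro sum.cong) (auto simp: component_def)
      also have "\<dots> = (if card C = k then (- 1) ^ inversions A (C - A) * f A * g (C - A) else 0)"
        using c by auto
      finally show "(\<Sum>i\<le>k. (- 1) ^ inversions A (C - A) * component i f A * component (k - i) g (C - A)) =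
          (if card C = k then (- 1) ^ inversions A (C - A) * f A * g (C - A) else 0)" .
    qed simp
    also have "\<dots> = component k (ext_mult f g) C"
      by (simp add: component_def ext_mult_def)
    finally show ?thesis by simp
  qed (simp add: component_def ext_mult_infinite sum_ext_apply)
qed

lemma F_in_R: "F n r \<in> carrier (R n)"
proof -
  have "F n r A = 0" if "\<not> A \<subseteq> {1..n}" for A
    unfolding F_def sum_ext_apply using that by (intro sum.neutral) (auto simp: theta_def)
  then show ?thesis by (auto simp: R_def)
qed

lemma ideal_I: "ideal (I n) (R n)"
  unfolding I_def by (rule ring.genideal_ideal[OF ring_R]) (use F_in_R in auto)

lemma component_in_I:
  assumes "p \<in> I n"
  shows "component k p \<in> I n"
proof -
  interpret I: ideal "I n" "R n" by (rule ideal_I)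
  let ?J = "{p \<in> carrier (R n). \<forall>k. component k p \<in> I n}"
  have zero: "0 \<in> I n"
    using I.zero_closed I.a_subgroup additive_subgroup.zero_closed[OF I.is_additive_subgroup]
    by (simp add: R_def)
  have add: "f + g \<in> I n" if "f \<in> I n" "g \<in> I n" for f g
    using additive_subgroup.a_closed[OF I.is_additive_subgroup that] by (simp add: R_def)
  have sum: "sum h X \<in> I n" if "\<And>x. x \<in> X \<Longrightarrow> h x \<in> I n" for h :: "nat \<Rightarrow> ext" and X
    using that by (induction X rule: infinite_finite_induct) (auto intro: zero add)
  have left: "ext_mult f g \<in> I n" if "f \<in> carrier (R n)" "g \<in> I n" for f g
    using I.I_l_closed[OF that(2,1)] by (simp add: R_def)
  have right: "ext_mult g f \<in> I n" if "f \<in> carrier (R n)" "g \<in> I n" for f g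
    using I.I_r_closed[OF that(2,1)] by (simp add: R_def)
  have sub: "I n \<subseteq> carrier (R n)"
    using I.a_Hcarr by blast
  have uminus: "- f \<in> I n" if "f \<in> I n" for f
  proof -
    have "ext_mult (- theta {}) f = - ext_mult (theta {}) f"
      by (auto simp: ext_mult_def fun_eq_iff sum_negf)
    then have "ext_mult (- theta {}) f = - f"
      using ext_mult_one(1) sub that by auto
    moreover have "- theta {} \<in> carrier (R n)"
      by (auto simp: R_def theta_def)
    ultimately show ?thesis using left[OF _ that] by metis
  qed
  have "ideal ?J (R n)"
  proof (rule idealI)
    show "ring (R n)" by (rule ring_R)
    show "subgroup ?J (add_monoid (R n))"
    proof (rule group.subgroupI)
      show "Group.group (add_monoid (R n))"
        using I.a_group .
      have "0 \<in> ?J" using zero by (auto simp: component_def R_def zero_fun_def)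
      then show "?J \<noteq> {}" by blast
      fix f assume f: "f \<in> ?J"
      have "- f \<in> carrier (R n)" using f by (auto simp: R_def)
      moreover have "f \<oplus>\<^bsub>R n\<^esub> - f = \<zero>\<^bsub>R n\<^esub>"
        by (simp add: R_def)
      ultimately have "inv\<^bsub>add_monoid (R n)\<^esub> f = - f"
        using f I.minus_equality[of "- f" f] I.a_comm by (simp add: a_inv_def)
      moreover have "component k (- f) = - component k f" for k
        by (auto simp: component_def fun_eq_iff)
      ultimately show "inv\<^bsub>add_monoid (R n)\<^esub> f \<in> ?J"
        using f uminus \<open>- f \<in> carrier (R n)\<close> by auto
      fix g assume g: "g \<in> ?J"
      have "f + g \<in> ?J" using f g add add_in_R by (auto simp: component_add)
      then show "f \<otimes>\<^bsub>add_monoid (R n)\<^esub> g \<in> ?J" by (simp add: R_def)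
    qed auto
    fix a x assume a: "a \<in> ?J" and x: "x \<in> carrier (R n)"
    have "ext_mult x a \<in> ?J" "ext_mult a x \<in> ?J"
      using a ext_mult_in_R[OF x] ext_mult_in_R[OF _ x] component_in_R[OF x]
      by (auto simp: component_mult intro!: sum intro: left right)
    then show "x \<otimes>\<^bsub>R n\<^esub> a \<in> ?J" "a \<otimes>\<^bsub>R n\<^esub> x \<in> ?J"
      by (simp_all add: R_def)
  qed
  moreover have "{F n r | r. 1 \<le> r \<and> r \<le> n} \<subseteq> ?J"
  proof -
    have "{F n r | r. 1 \<le> r \<and> r \<le> n} \<subseteq> I n"
      unfolding I_def by (rule ring.genideal_self[OF ring_R]) (use F_in_R in auto)
    then show ?thesis
      using zero F_in_R by (auto simp: component_F)
  qed
  ultimately have "I n \<subseteq> ?J"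
    unfolding I_def by (rule ring.genideal_minimal[OF ring_R])
  then show ?thesis using assms by blast
qed

lemma EQH_graded:
  assumes "q \<in> EQH n"
  shows "component k q \<in> EQH n \<inter> R_deg n k"
proof -
  have q: "q \<in> carrier (R n)" using assms by (simp add: EQH_def)
  have "ext_inner n p (component k q) = 0" if "p \<in> I n" for p
  proof -
    have "ext_inner n p (component k q) = ext_inner n (component k p) q"
      unfolding ext_inner_eq by (intro sum.cong) (auto simp: component_def)
    then show ?thesis using assms component_in_I[OF that] by (simp add: EQH_def)
  qed
  then show ?thesis
    using component_in_R[OF q] by (auto simp: EQH_def R_deg_def component_def)
qed

end

theory Submission
  imports Defs
begin

text \<open>
  Let \<open>D\<^sub>r\<close> be the adjoint of right multiplication by \<open>F\<^sub>r\<close>. Since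
  \<open>F\<^sub>r\<close> commutes with homogeneous elements up to sign, and \<open>D\<^sub>r\<close> is up to a nonzero scalar
  \<open>D\<^sub>1\<close>, or \<open>D\<^sub>s \<circ> D\<^sub>2\<close> with \<open>s = r - 2\<close>, the harmonics are the common kernel of
  \<open>D\<^sub>1\<close> and \<open>D\<^sub>2\<close>. Write \<open>f = g + h \<theta>\<close> with \<open>\<theta>\<close> the last of \<open>n + 1\<close> variables. Then
  \<open>D\<^sub>1 f = (D\<^sub>1 g + h) - (D\<^sub>1 h) \<theta>\<close> and \<open>D\<^sub>2 f = (D\<^sub>2 g + D\<^sub>1 h) + (D\<^sub>2 h) \<theta>\<close>.

  So \<open>f\<close> is harmonic iff \<open>h = - D\<^sub>1 g\<close> and \<open>D\<^sub>2 g = 0\<close>, and then \<open>h\<close> is harmonic. Rank-nullity for \<open>D\<^sub>2\<close>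
  on \<open>n\<close> variables bounds the dimension in degree \<open>k\<close> below by \<open>C(n + 1, k) - C(n + 1, k - 1)\<close>.
  Rank-nullity for \<open>f \<mapsto> h\<close> gives the Pascal-type inequality for the matching upper bound; its
  boundary values are \<open>0\<close> by the hard-Lefschetz-type injectivity of powers of \<open>D\<^sub>2\<close> in
  degrees above the middle. The same numbers count two-row standard tableaux, by removal of
  the largest entry.
\<close>

section \<open>Linear algebra\<close>

text \<open>\<open>dim\<close> is the cardinality of a basis, hence 0 in infinite dimension; so the
  larger set is confined to a finitely generated span.\<close>

lemma (in vector_space) dim_mono_finite:
  assumes "V \<subseteq> W" "W \<subseteq> span S" "finite S"
  shows "dim V \<le> dim W"
proof -
  obtain B where B: "B \<subseteq> W" "independent B" "W \<subseteq> span B" "card B = dim W"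
    by (rule basis_exists)
  have "finite B"
    using independent_span_bound[OF assms(3) B(2)] B(1) assms(2) by blast
  with B assms(1) show ?thesis
    using dim_le_card[of V B] by auto
qed

text \<open>The half of rank-nullity used below: a basis of the kernel in \<open>S\<close> and
  preimages of a basis of the image together span \<open>S\<close>.\<close>

lemma (in Vector_Spaces.linear) dim_le_kernel_image:
  assumes S: "vs1.subspace S" "S \<subseteq> vs1.span W" "finite W"
  shows "vs1.dim S \<le> vs1.dim {x \<in> S. f x = 0} + vs2.dim (f ` S)"
proof -
  let ?K = "{x \<in> S. f x = 0}"
  obtain B where B: "B \<subseteq> ?K" "vs1.independent B" "?K \<subseteq> vs1.span B" "card B = vs1.dim ?K"
    by (rule vs1.basis_exists)
  have fB: "finite B"
    using vs1.independent_span_bound[OF S(3) B(2)] B(1) S(2) by blast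
  obtain C where C: "C \<subseteq> f ` S" "vs2.independent C" "f ` S \<subseteq> vs2.span C" "card C = vs2.dim (f ` S)"
    by (rule vs2.basis_exists)
  have "f ` S \<subseteq> vs2.span (f ` W)"
    using S(2) span_image[of W] by auto
  then have fC: "finite C"
    using vs2.independent_span_bound[OF _ C(2), of "f ` W"] C(1) S(3) by auto
  obtain D where D: "D \<subseteq> S" "inj_on f D" "C = f ` D"
    using C(1) by (meson subset_image_inj)
  then have fD: "finite D" "card D = card C"
    using fC by (auto simp: finite_image_iff card_image)
  have "S \<subseteq> vs1.span (B \<union> D)"
  proof
    fix x assume x: "x \<in> S"
    then have "f x \<in> f ` vs1.span D"
      using C(3) D(3) span_image[of D] by auto
    then obtain y where y: "y \<in> vs1.span D" "f x = f y" by blast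
    have "y \<in> S"
      using y(1) D(1) S(1) by (meson vs1.span_minimal subsetD)
    then have "x - y \<in> ?K"
      using x y(2) S(1) by (simp add: diff vs1.subspace_diff)
    then have "x - y \<in> vs1.span (B \<union> D)" "y \<in> vs1.span (B \<union> D)"
      using B(3) y(1) vs1.span_mono[of B "B \<union> D"] vs1.span_mono[of D "B \<union> D"] by auto
    then show "x \<in> vs1.span (B \<union> D)"
      using vs1.span_add by fastforce
  qed
  then have "vs1.dim S \<le> card (B \<union> D)"
    using fB fD(1) by (intro vs1.dim_le_card) auto
  also have "\<dots> \<le> card B + card D" by (rule card_Un_le)
  finally show ?thesis using B(4) C(4) fD(2) by simp
qed

lemma linear_extI:
  assumes "\<And>f g. T (f + g) = T f + T g" "\<And>c f. T (ext_scale c f) = ext_scale c (T f)"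
  shows "Vector_Spaces.linear ext_scale ext_scale T"
  using assms ext.vector_space_axioms by (simp add: Vector_Spaces.linear_iff)

section \<open>Coordinates and dimensions of the homogeneous parts\<close>

lemma mem_R: "f \<in> carrier (R n) \<longleftrightarrow> (\<forall>A. f A \<noteq> 0 \<longrightarrow> A \<subseteq> {1..n})"
  by (simp add: R_def)

lemma mem_R_deg: "f \<in> R_deg n k \<longleftrightarrow> (\<forall>A. f A \<noteq> 0 \<longrightarrow> A \<subseteq> {1..n} \<and> card A = k)"
  by (auto simp: R_deg_def mem_R)

definition mono_basis :: "nat \<Rightarrow> nat \<Rightarrow> ext set"
  where "mono_basis n k = theta ` {A. A \<subseteq> {1..n} \<and> card A = k}"

lemma inj_theta: "inj theta"
  by (rule injI) (metis theta_def zero_neq_one)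

lemma finite_mono_basis [simp]: "finite (mono_basis n k)"
  and card_mono_basis: "card (mono_basis n k) = n choose k"
  using n_subsets[of "{1..n}" k]
  by (auto simp: mono_basis_def card_image inj_on_subset[OF inj_theta])

lemma theta_expansion:
  assumes "f \<in> R_deg n k"
  shows "f = (\<Sum>A | A \<subseteq> {1..n} \<and> card A = k. ext_scale (f A) (theta A))"
proof
  fix B
  have fin: "finite {A. A \<subseteq> {1..n} \<and> card A = k}" by simp
  have "(\<Sum>A | A \<subseteq> {1..n} \<and> card A = k. ext_scale (f A) (theta A)) B =
      (\<Sum>A | A \<subseteq> {1..n} \<and> card A = k. if A = B then f B else 0)"
    unfolding sum_ext_apply by (intro sum.cong) (auto simp: ext_scale_def theta_def)
  also have "\<dots> = f B"
    using fin assms by (auto simp: mem_R_deg)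
  finally show "f B = (\<Sum>A | A \<subseteq> {1..n} \<and> card A = k. ext_scale (f A) (theta A)) B" ..
qed

lemma R_deg_subset_span: "R_deg n k \<subseteq> ext.span (mono_basis n k)"
proof
  fix f assume f: "f \<in> R_deg n k"
  have "(\<Sum>A | A \<subseteq> {1..n} \<and> card A = k. ext_scale (f A) (theta A)) \<in> ext.span (mono_basis n k)"
    by (intro ext.span_sum ext.span_scale ext.span_base) (auto simp: mono_basis_def)
  then show "f \<in> ext.span (mono_basis n k)"
    using theta_expansion[OF f] by simp
qed

lemma independent_mono_basis: "ext.independent (mono_basis n k)"
proof (rule ext.independent_if_scalars_zero)
  show "finite (mono_basis n k)" by simp
  fix u x
  assume 0: "(\<Sum>x\<in>mono_basis n k. ext_scale (u x) x) = 0" and x: "x \<in> mono_basis n k"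
  then obtain B where B: "x = theta B" "B \<subseteq> {1..n}" "card B = k"
    by (auto simp: mono_basis_def)
  have "0 = (\<Sum>x\<in>mono_basis n k. ext_scale (u x) x) B"
    using 0 by simp
  also have "\<dots> = (\<Sum>A | A \<subseteq> {1..n} \<and> card A = k. ext_scale (u (theta A)) (theta A) B)"
    unfolding mono_basis_def sum_ext_apply
    by (simp add: sum.reindex inj_on_subset[OF inj_theta])
  also have "\<dots> = (\<Sum>A | A \<subseteq> {1..n} \<and> card A = k. if A = B then u x else 0)"
    by (intro sum.cong) (simp_all add: ext_scale_def B(1), simp add: theta_def)
  also have "\<dots> = u x" using B by simp
  finally show "u x = 0" ..
qed

lemma dim_R_deg: "ext.dim (R_deg n k) = n choose k"
proof (rule ext.dim_unique[OF _ R_deg_subset_span independent_mono_basis card_mono_basis])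
  show "mono_basis n k \<subseteq> R_deg n k"
    by (auto simp: mono_basis_def mem_R_deg theta_def split: if_splits)
qed

lemma subspace_R_deg: "ext.subspace (R_deg n k)"
proof (rule ext.subspaceI)
  fix f g assume "f \<in> R_deg n k" "g \<in> R_deg n k"
  then show "f + g \<in> R_deg n k"
    unfolding mem_R_deg by (metis add.right_neutral plus_fun_apply)
qed (auto simp: mem_R_deg ext_scale_def)

section \<open>Contractions\<close>

text \<open>The adjoint of right multiplication by \<open>F n r\<close>; see \<open>ext_inner_mult_F\<close>.\<close>

definition contract :: "nat \<Rightarrow> nat \<Rightarrow> ext \<Rightarrow> ext"
  where "contract n r f = (\<lambda>B. if B \<subseteq> {1..n} then
    \<Sum>A | A \<subseteq> {1..n} - B \<and> card A = r. (- 1) ^ inversions B A * f (B \<union> A) else 0)"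

text \<open>\<open>g + h \<theta>\<close>, where \<open>\<theta>\<close> is the variable of index \<open>n + 1\<close>.\<close>

definition glue :: "nat \<Rightarrow> ext \<Rightarrow> ext \<Rightarrow> ext"
  where "glue n g h = (\<lambda>B. if Suc n \<in> B then h (B - {Suc n}) else g B)"

lemma contract_add: "contract n r (f + g) = contract n r f + contract n r g"
  and contract_scale: "contract n r (ext_scale c f) = ext_scale c (contract n r f)"
  by (auto simp: contract_def ext_scale_def fun_eq_iff algebra_simps sum.distrib sum_distrib_left)

lemma linear_contract: "Vector_Spaces.linear ext_scale ext_scale (contract n r)"
  by (rule linear_extI[OF contract_add contract_scale])

lemma contract_zero [simp]: "contract n r 0 = 0"
  by (auto simp: contract_def)

lemma contract_uminus: "contract n r (- f) = - contract n r f"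
  by (auto simp: contract_def fun_eq_iff sum_negf)

lemma contract_in_R [simp]: "contract n r f \<in> carrier (R n)"
  by (auto simp: contract_def mem_R)

lemma contract_0: "f \<in> carrier (R n) \<Longrightarrow> contract n 0 f = f"
proof -
  assume f: "f \<in> carrier (R n)"
  have "contract n 0 f B = f B" for B
  proof (cases "B \<subseteq> {1..n}")
    case True
    \<comment> \<open>\<open>card\<close> is 0 on infinite sets as well, so finiteness is what
      leaves only the empty set.\<close>
    have "finite A" if "A \<subseteq> {1..n} - B" for A
      using that by (rule finite_subset) simp
    then have "{A. A \<subseteq> {1..n} - B \<and> card A = 0} = {{}}"
      by (auto simp only: card_eq_0_iff)
    then show ?thesis using True by (simp add: contract_def)
  qed (use f in \<open>auto simp: contract_def mem_R\<close>)
  then show ?thesis by blast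
qed

lemma contract_no_variables: "contract 0 (Suc r) f = 0"
proof -
  have "{A. A \<subseteq> {1..0} - B \<and> card A = Suc r} = {}" for B :: "nat set"
    by (auto simp: subset_empty)
  then show ?thesis
    unfolding contract_def by (simp only: sum.empty) auto
qed

section \<open>Splitting off the last variable\<close>

lemma glue_add: "glue n a b + glue n c d = glue n (a + c) (b + d)"
  and glue_scale: "ext_scale u (glue n a b) = glue n (ext_scale u a) (ext_scale u b)"
  and glue_zero: "glue n 0 0 = 0"
  by (auto simp: glue_def ext_scale_def fun_eq_iff)

lemma uminus_in_R: "f \<in> carrier (R n) \<Longrightarrow> - f \<in> carrier (R n)"
  and scale_in_R: "f \<in> carrier (R n) \<Longrightarrow> ext_scale c f \<in> carrier (R n)"
  and zero_in_R: "0 \<in> carrier (R n)"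
  by (auto simp: mem_R ext_scale_def)

lemma glue_eq_iff:
  assumes "a \<in> carrier (R n)" "b \<in> carrier (R n)" "c \<in> carrier (R n)" "d \<in> carrier (R n)"
  shows "glue n a b = glue n c d \<longleftrightarrow> a = c \<and> b = d"
proof
  assume eq: "glue n a b = glue n c d"
  have "a B = c B \<and> b B = d B" for B
  proof (cases "Suc n \<in> B")
    case True
    then show ?thesis using assms unfolding mem_R
      by (metis Suc_n_not_le_n atLeastAtMost_iff subsetD)
  next
    case False
    then show ?thesis
      using fun_cong[OF eq, of B] fun_cong[OF eq, of "insert (Suc n) B"] by (simp add: glue_def)
  qed
  then show "a = c \<and> b = d" by blast
qed simp

lemma glue_eq_0_iff:
  assumes "a \<in> carrier (R n)" "b \<in> carrier (R n)"
  shows "glue n a b = 0 \<longleftrightarrow> a = 0 \<and> b = 0"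
  using glue_eq_iff[OF assms zero_in_R zero_in_R] by (simp add: glue_zero)

lemma glue_cases:
  assumes "f \<in> carrier (R (Suc n))"
  obtains g h where "g \<in> carrier (R n)" "h \<in> carrier (R n)" "f = glue n g h"
proof
  \<comment> \<open>Setting both parts to 0 on sets containing \<open>Suc n\<close> puts them in
    \<open>R n\<close>.\<close>
  let ?g = "\<lambda>B. if Suc n \<in> B then 0 else f B"
  let ?h = "\<lambda>B. if Suc n \<in> B then 0 else f (insert (Suc n) B)"
  show "?g \<in> carrier (R n)" "?h \<in> carrier (R n)"
    using assms by (fastforce simp: mem_R atLeastAtMostSuc_conv)+
  show "f = glue n ?g ?h"
    by (auto simp: glue_def fun_eq_iff insert_absorb)
qed

text \<open>The last variable adds one to the degree of the second component; degree 0 has no room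
  for it, whence \<open>h = 0\<close>.\<close>

lemma glue_in_R_deg:
  assumes "g \<in> carrier (R n)" "h \<in> carrier (R n)"
  shows "glue n g h \<in> R_deg (Suc n) k \<longleftrightarrow>
    g \<in> R_deg n k \<and> (case k of 0 \<Rightarrow> h = 0 | Suc j \<Rightarrow> h \<in> R_deg n j)"
proof -
  have ins: "B \<subseteq> {1..n} \<Longrightarrow> card (insert (Suc n) B) = Suc (card B)" for B
    by (subst card_insert_disjoint) (auto dest: finite_subset)
  have "glue n g h \<in> R_deg (Suc n) k \<longleftrightarrow>
     (\<forall>B. g B \<noteq> 0 \<longrightarrow> card B = k) \<and> (\<forall>B. h B \<noteq> 0 \<longrightarrow> Suc (card B) = k)"
  proof (intro iffI conjI allI impI)
    assume j: "glue n g h \<in> R_deg (Suc n) k"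
    fix B
    show "card B = k" if B: "g B \<noteq> 0"
    proof -
      have "B \<subseteq> {1..n}" using B assms by (simp add: mem_R)
      then have "glue n g h B = g B" by (auto simp: glue_def)
      then show ?thesis using j B unfolding mem_R_deg by metis
    qed
    show "Suc (card B) = k" if B: "h B \<noteq> 0"
    proof -
      have sub: "B \<subseteq> {1..n}" using B assms by (simp add: mem_R)
      then have "glue n g h (insert (Suc n) B) = h B"
        by (auto simp: glue_def intro!: arg_cong[of _ _ h])
      then show ?thesis using j B ins[OF sub] unfolding mem_R_deg by metis
    qed
  next
    assume *: "(\<forall>B. g B \<noteq> 0 \<longrightarrow> card B = k) \<and> (\<forall>B. h B \<noteq> 0 \<longrightarrow> Suc (card B) = k)"
    show "glue n g h \<in> R_deg (Suc n) k"
      unfolding mem_R_deg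
    proof (intro allI impI)
      fix A assume A: "glue n g h A \<noteq> 0"
      show "A \<subseteq> {1..Suc n} \<and> card A = k"
      proof (cases "Suc n \<in> A")
        case True
        then have h: "h (A - {Suc n}) \<noteq> 0" using A by (simp add: glue_def)
        then have sub: "A - {Suc n} \<subseteq> {1..n}" using assms by (simp add: mem_R)
        have "card (insert (Suc n) (A - {Suc n})) = k" using ins[OF sub] * h by simp
        then have "card A = k" using True by (simp add: insert_absorb)
        then show ?thesis using sub True by (auto simp: atLeastAtMostSuc_conv)
      next
        case False
        then have "g A \<noteq> 0" using A by (simp add: glue_def)
        then show ?thesis using * assms(1) by (fastforce simp: mem_R)
      qed
    qed
  qed
  then show ?thesis
    using assms by (auto simp: mem_R_deg mem_R fun_eq_iff split: nat.split)
qed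

text \<open>The index \<open>Suc n\<close> exceeds all others, so on the left it is inverted with
  every element of \<open>A\<close>. This is the source of the sign in
  \<open>contract_glue\<close>.\<close>

lemma inversions_insert_Suc_left:
  assumes "B \<subseteq> {1..n}" "A \<subseteq> {1..n}"
  shows "inversions (insert (Suc n) B) A = inversions B A + card A"
proof -
  have fin: "finite A" "finite B" using assms by (auto dest: finite_subset)
  have "{(a, b). a \<in> {Suc n} \<and> b \<in> A \<and> b < a} = Pair (Suc n) ` A"
    using assms by (auto simp: image_iff le_imp_less_Suc subset_iff)
  then have "inversions {Suc n} A = card A"
    by (simp add: inversions_def card_image inj_on_def)
  moreover have "inversions ({Suc n} \<union> B) A = inversions {Suc n} A + inversions B A"
    by (rule inversions_Un_left) (use fin assms in auto)
  ultimately show ?thesis by simp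
qed

lemma inversions_insert_Suc_right:
  assumes "B \<subseteq> {1..n}"
  shows "inversions B (insert (Suc n) A) = inversions B A"
proof -
  have "{(a, b). a \<in> B \<and> b \<in> insert (Suc n) A \<and> b < a} = {(a, b). a \<in> B \<and> b \<in> A \<and> b < a}"
    using assms by fastforce
  then show ?thesis by (simp add: inversions_def)
qed

text \<open>Sort the sets \<open>A\<close> of size \<open>Suc r\<close> by whether they contain
  \<open>Suc n\<close>. If they do, \<open>r\<close> indices remain to be contracted from
  \<open>h\<close>, without a sign. If \<open>Suc n\<close> lies in \<open>B\<close> instead, only
  \<open>h\<close> is seen, and moving the last variable past \<open>A\<close> gives the
  sign.\<close>

lemma contract_glue:
  "contract (Suc n) (Suc r) (glue n g h) =
    glue n (contract n (Suc r) g + contract n r h) (ext_scale ((- 1) ^ Suc r) (contract n (Suc r) h))"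
proof
  fix B
  let ?lhs = "contract (Suc n) (Suc r) (glue n g h)"
  let ?rhs = "glue n (contract n (Suc r) g + contract n r h)
    (ext_scale ((- 1) ^ Suc r) (contract n (Suc r) h))"
  consider "\<not> B \<subseteq> {1..Suc n}" | "B \<subseteq> {1..n}"
    | B' where "B = insert (Suc n) B'" "B' \<subseteq> {1..n}"
  proof (cases "B \<subseteq> {1..Suc n}")
    case True
    then have "B - {Suc n} \<subseteq> {1..n}" by (auto simp: subset_iff le_Suc_eq)
    then show ?thesis using that by (metis Diff_empty Diff_insert0 insert_Diff)
  qed
  then show "?lhs B = ?rhs B"
  proof cases
    case 1
    then have "\<not> B - {Suc n} \<subseteq> {1..n}" "\<not> B \<subseteq> {1..n}"
      by (auto simp: atLeastAtMostSuc_conv)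
    then show ?thesis using 1 by (auto simp: contract_def glue_def ext_scale_def)
  next
    case 2
    have notin: "Suc n \<notin> B" using 2 by auto
    let ?X = "{A. A \<subseteq> {1..n} - B \<and> card A = Suc r}"
    let ?Y = "{A. A \<subseteq> {1..n} - B \<and> card A = r}"
    have fin: "finite A" if "A \<subseteq> {1..n} - B" for A
      using that by (rule finite_subset) simp
    have split: "{A. A \<subseteq> {1..Suc n} - B \<and> card A = Suc r} = ?X \<union> insert (Suc n) ` ?Y" (is "?Z = ?W")
    proof (rule Set.set_eqI, rule iffI)
      fix A assume A: "A \<in> ?Z"
      show "A \<in> ?X \<union> insert (Suc n) ` ?Y"
      proof (cases "Suc n \<in> A")
        case True
        then have "A = insert (Suc n) (A - {Suc n})" by auto
        moreover have "A - {Suc n} \<in> ?Y"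
          using A True by (auto simp: atLeastAtMostSuc_conv)
        ultimately show ?thesis by blast
      qed (use A in \<open>auto simp: atLeastAtMostSuc_conv\<close>)
    next
      fix A assume A: "A \<in> ?X \<union> insert (Suc n) ` ?Y"
      have "card (insert (Suc n) A') = Suc r" if "A' \<in> ?Y" for A'
        using that by (subst card_insert_disjoint) (use fin[of A'] in auto)
      then show "A \<in> ?Z" using A notin by (auto simp: atLeastAtMostSuc_conv)
    qed
    have inj: "inj_on (insert (Suc n)) ?Y"
      by (rule inj_onI) (auto dest!: insert_ident[THEN iffD1, rotated 2])
    let ?t = "\<lambda>A. (- 1) ^ inversions B A * glue n g h (B \<union> A)"
    have "?lhs B = sum ?t ?Z" using 2 by (auto simp: contract_def)
    also have "\<dots> = sum ?t ?X + sum ?t (insert (Suc n) ` ?Y)"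
      unfolding split by (rule sum.union_disjoint) auto
    also have "sum ?t ?X = contract n (Suc r) g B"
      using 2 notin by (auto simp: contract_def glue_def intro!: sum.cong)
    also have "sum ?t (insert (Suc n) ` ?Y) = (\<Sum>A\<in>?Y. ?t (insert (Suc n) A))"
      using sum.reindex[OF inj, of ?t] by simp
    also have "\<dots> = contract n r h B"
    proof -
      have "(B \<union> A) - {Suc n} = B \<union> A" if "A \<in> ?Y" for A
        using notin that by auto
      then show ?thesis
        using 2 by (auto simp: contract_def glue_def inversions_insert_Suc_right intro!: sum.cong)
    qed
    finally show ?thesis using notin by (simp add: glue_def)
  next
    case 3
    have notin: "Suc n \<notin> B'" using 3 by auto
    have eq: "{1..Suc n} - B = {1..n} - B'" "B \<subseteq> {1..Suc n}" using 3 by auto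
    have "?lhs B = (\<Sum>A | A \<subseteq> {1..n} - B' \<and> card A = Suc r.
        (- 1) ^ inversions B A * glue n g h (B \<union> A))"
      unfolding contract_def eq(1) using eq(2) by simp
    also have "\<dots> = (\<Sum>A | A \<subseteq> {1..n} - B' \<and> card A = Suc r.
        (- 1) ^ (inversions B' A + Suc r) * h (B' \<union> A))"
    proof (rule sum.cong)
      fix A assume "A \<in> {A. A \<subseteq> {1..n} - B' \<and> card A = Suc r}"
      then have A: "A \<subseteq> {1..n}" "card A = Suc r" by auto
      then have "B \<union> A - {Suc n} = B' \<union> A" using 3 by auto
      then have "glue n g h (B \<union> A) = h (B' \<union> A)" by (simp add: glue_def 3(1))
      then show "(- 1) ^ inversions B A * glue n g h (B \<union> A) =
          (- 1) ^ (inversions B' A + Suc r) * h (B' \<union> A)"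
        using inversions_insert_Suc_left[OF 3(2) A(1)] A(2) by (simp only: 3(1))
    qed simp
    also have "\<dots> = ?rhs B"
      using 3 notin
      by (simp add: glue_def contract_def ext_scale_def power_add sum_distrib_left sum_negf mult_ac)
    finally show ?thesis .
  qed
qed

text \<open>
  With these rules active, the simplifier turns equations between functions into
  \<open>\<lambda>\<close>-abstractions, which blocks the point-free calculations with \<open>contract\<close>.
\<close>

declare plus_fun_apply [simp del] zero_fun_apply [simp del]
  minus_apply [simp del] uminus_apply [simp del]

lemma glue_zero_right: "g \<in> carrier (R n) \<Longrightarrow> glue n g 0 = g"
  by (fastforce simp: glue_def mem_R fun_eq_iff zero_fun_apply)

section \<open>Relations among the contractions\<close>

lemma contract_glue_1:
  assumes "h \<in> carrier (R n)"
  shows "contract (Suc n) 1 (glue n g h) = glue n (contract n 1 g + h) (- contract n 1 h)"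
  using contract_glue[of n 0 g h] contract_0[OF assms] by simp

lemma contract_glue_2:
  "contract (Suc n) 2 (glue n g h) = glue n (contract n 2 g + contract n 1 h) (contract n 2 h)"
  using contract_glue[of n 1 g h] by (simp add: numeral_2_eq_2)

text \<open>Adjoint to the product F_r F_1, whose coefficient at each monomial of degree
  \<open>r + 1\<close> is an alternating sum of \<open>r + 1\<close> signs. Induction on the number
  of variables replaces the manipulation of these sums.\<close>

lemma contract_contract_1:
  "f \<in> carrier (R n) \<Longrightarrow>
    contract n r (contract n 1 f) = (if even r then contract n (Suc r) f else 0)"
proof (induction n arbitrary: r f)
  case 0
  have "contract 0 1 f = 0" using contract_no_variables[of 0] by simp
  then show ?case by (simp only: contract_no_variables contract_zero if_cancel)
next
  case (Suc n)
  obtain g h where gh: "g \<in> carrier (R n)" "h \<in> carrier (R n)" and f: "f = glue n g h"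
    using Suc.prems by (rule glue_cases)
  show ?case
  proof (cases r)
    case 0
    then show ?thesis by (simp add: contract_0)
  next
    case (Suc s)
    \<comment> \<open>\<open>r\<close> and \<open>s\<close> have opposite parity: the subtracted
      term vanishes for even \<open>r\<close> and cancels \<open>contract n r h\<close> for odd
      \<open>r\<close>.\<close>
    have "contract (Suc n) r (contract (Suc n) 1 f) =
        glue n (contract n r (contract n 1 g) + contract n r h - contract n s (contract n 1 h))
          (ext_scale ((- 1) ^ s) (contract n r (contract n 1 h)))"
      unfolding f contract_glue_1[OF gh(2)] Suc contract_glue
      by (simp add: contract_add contract_uminus)
    then show ?thesis
      using Suc.IH[OF gh(1), of r] Suc.IH[OF gh(2), of r] Suc.IH[OF gh(2), of s]
      by (cases "even r") (simp_all add: Suc f contract_glue glue_zero)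
  qed
qed

text \<open>Adjoint to F_r F_2; the scalar is the Gaussian binomial coefficient of
  \<open>r + 2\<close> over 2 at q = -1, which is never 0.\<close>

lemma contract_contract_2:
  "f \<in> carrier (R n) \<Longrightarrow> contract n r (contract n 2 f) =
    ext_scale (of_nat (Suc (r div 2))) (contract n (Suc (Suc r)) f)"
proof (induction n arbitrary: r f)
  case 0
  have "contract 0 2 f = 0" using contract_no_variables[of 1] by (simp add: numeral_2_eq_2)
  then show ?case by (simp only: contract_no_variables contract_zero ext.scale_zero_right)
next
  case (Suc n)
  obtain g h where gh: "g \<in> carrier (R n)" "h \<in> carrier (R n)" and f: "f = glue n g h"
    using Suc.prems by (rule glue_cases)
  show ?case
  proof (cases r)
    case 0
    then show ?thesis by (simp add: contract_0 numeral_2_eq_2)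
  next
    case (Suc s)
    have "contract (Suc n) r (contract (Suc n) 2 f) =
        glue n (contract n r (contract n 2 g) + contract n r (contract n 1 h) + contract n s (contract n 2 h))
          (ext_scale ((- 1) ^ r) (contract n r (contract n 2 h)))"
      unfolding f contract_glue_2 Suc contract_glue by (simp add: contract_add)
    also have "\<dots> = ext_scale (of_nat (Suc (r div 2))) (contract (Suc n) (Suc (Suc r)) f)"
      unfolding f contract_glue glue_scale Suc.IH[OF gh(1)] Suc.IH[OF gh(2)] contract_contract_1[OF gh(2)]
      by (rule arg_cong2[of _ _ _ _ "glue n"])
        (auto simp: Suc ext_scale_def fun_eq_iff plus_fun_apply zero_fun_apply algebra_simps elim!: evenE oddE)
    finally show ?thesis .
  qed
qed

lemma contract_1_1: "f \<in> carrier (R n) \<Longrightarrow> contract n 1 (contract n 1 f) = 0"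
  using contract_contract_1[of f n 1] by simp

text \<open>Both composites are \<open>contract n 3\<close>.\<close>

lemma contract_2_1:
  "f \<in> carrier (R n) \<Longrightarrow> contract n 2 (contract n 1 f) = contract n 1 (contract n 2 f)"
  using contract_contract_1[of f n 2] contract_contract_2[of f n 1] by (simp add: numeral_3_eq_3)

lemma contract_pow_in_R: "f \<in> carrier (R n) \<Longrightarrow> (contract n r ^^ j) f \<in> carrier (R n)"
  by (cases j) auto

text \<open>D_2 acts on the pair \<open>g\<close>, \<open>h\<close> as a triangular matrix with D_2
  on the diagonal and D_1 off it. These commute, so the off-diagonal entry of a power behaves like
  the derivative of a power.\<close>

lemma contract_pow_glue:
  assumes "g \<in> carrier (R n)" "h \<in> carrier (R n)"
  shows "(contract (Suc n) 2 ^^ Suc j) (glue n g h) =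
    glue n ((contract n 2 ^^ Suc j) g + ext_scale (of_nat (Suc j)) (contract n 1 ((contract n 2 ^^ j) h)))
      ((contract n 2 ^^ Suc j) h)"
proof (induction j)
  case 0
  show ?case by (simp only: contract_glue_2 funpow_0 funpow.simps o_apply of_nat_Suc of_nat_0 add_0_right
      ext.scale_one id_apply One_nat_def)
next
  case (Suc j)
  let ?D = "contract n 2 ^^ j"
  have "(contract (Suc n) 2 ^^ Suc (Suc j)) (glue n g h) =
      contract (Suc n) 2 (glue n (contract n 2 (?D g) + ext_scale (of_nat (Suc j)) (contract n 1 (?D h)))
        (contract n 2 (?D h)))"
    using Suc by simp
  also have "\<dots> = glue n (contract n 2 (contract n 2 (?D g)) +
      ext_scale (of_nat (Suc j)) (contract n 1 (contract n 2 (?D h))) + contract n 1 (contract n 2 (?D h)))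
      (contract n 2 (contract n 2 (?D h)))"
    unfolding contract_glue_2 contract_add contract_scale
    using contract_2_1[OF contract_pow_in_R[OF assms(2)], of j 2] by simp
  finally show ?case
    by (simp only: ext.scale_left_distrib ext.scale_one of_nat_Suc funpow.simps o_apply add.assoc add.commute add.left_commute)
qed

section \<open>Injectivity of powers of D_2 above the middle degree\<close>

lemma R_deg_in_R: "f \<in> R_deg n k \<Longrightarrow> f \<in> carrier (R n)"
  by (simp add: R_deg_def)

lemma R_deg_trivial: "n < k \<Longrightarrow> f \<in> R_deg n k \<Longrightarrow> f = 0"
proof (rule ext, rule ccontr)
  fix A assume "n < k" "f \<in> R_deg n k" "f A \<noteq> 0 A"
  then have "A \<subseteq> {1..n}" "card A = k" by (auto simp: mem_R_deg zero_fun_apply)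
  then show False using \<open>n < k\<close> card_mono[of "{1..n}" A] by simp
qed

text \<open>
  The induction peels off two variables at a time and needs all powers at once: the part free of
  both is killed by the power \<open>j + 1\<close>, the part divisible by both by the power \<open>j - 1\<close>.
\<close>

lemma contract_2_pow_injective:
  "n + 2 * j \<le> 2 * k \<Longrightarrow> f \<in> R_deg n k \<Longrightarrow> (contract n 2 ^^ j) f = 0 \<Longrightarrow> f = 0"
proof (induction n arbitrary: j k f rule: less_induct)
  case (less n)
  show ?case
  proof (cases j)
    case 0
    then show ?thesis using less.prems by simp
  next
    case j: (Suc i)
    \<comment> \<open>For \<open>j \<ge> 1\<close> the hypothesis gives
      \<open>n + 2 \<le> 2 * k\<close>, which forces \<open>n < k\<close> when \<open>n\<close> is 0
      or 1.\<close>
    consider "n < k" | m where "n = Suc (Suc m)"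
      using less.prems(1) j by (cases n; cases "n - 1") auto
    then show ?thesis
    proof cases
      case 1
      then show ?thesis using less.prems(2) by (rule R_deg_trivial)
    next
      case (2 m)
      obtain k' where k: "k = Suc (Suc k')"
        using less.prems(1) 2 j by (cases k; cases "k - 1") auto
      \<comment> \<open>With x and y the last two variables, the element becomes f = a + b x + c y +
        d x y.\<close>
      obtain g h where gh: "g \<in> carrier (R (Suc m))" "h \<in> carrier (R (Suc m))"
          "f = glue (Suc m) g h"
        using R_deg_in_R[OF less.prems(2)] unfolding 2 by (rule glue_cases)
      obtain a b where ab: "a \<in> carrier (R m)" "b \<in> carrier (R m)" "g = glue m a b"
        using gh(1) by (rule glue_cases)
      obtain c d where cd: "c \<in> carrier (R m)" "d \<in> carrier (R m)" "h = glue m c d"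
        using gh(2) by (rule glue_cases)
      have deg: "a \<in> R_deg m k" "b \<in> R_deg m (Suc k')" "c \<in> R_deg m (Suc k')" "d \<in> R_deg m k'"
      proof -
        have "g \<in> R_deg (Suc m) (Suc (Suc k'))" "h \<in> R_deg (Suc m) (Suc k')"
          using less.prems(2) glue_in_R_deg[OF gh(1,2)] by (simp_all add: 2 gh(3) k)
        then show "a \<in> R_deg m k" "b \<in> R_deg m (Suc k')" "c \<in> R_deg m (Suc k')" "d \<in> R_deg m k'"
          using glue_in_R_deg[OF ab(1,2)] glue_in_R_deg[OF cd(1,2)] by (simp_all add: k ab(3) cd(3))
      qed
      let ?D1 = "contract m 1" and ?D2 = "contract m 2"
      let ?X = "?D2 ^^ i" and ?Y = "?D2 ^^ Suc i"
      define s :: rat where "s = of_nat (Suc i)"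
      have s: "s \<noteq> 0" unfolding s_def by (simp only: of_nat_eq_0_iff)
      have XR: "?X u \<in> carrier (R m)" if "u \<in> carrier (R m)" for u
        using that by (rule contract_pow_in_R)
      \<comment> \<open>\<open>w\<close> is the correction term of \<open>contract_pow_glue\<close>,
        absent for \<open>i = 0\<close>; the argument uses only that D_1 kills it.\<close>
      obtain w where w: "w \<in> carrier (R m)" "?D1 w = 0"
          "(contract (Suc m) 2 ^^ i) h = glue m (?X c + w) (?X d)"
      proof (cases i)
        case 0
        then show ?thesis using that[of 0] by (simp add: cd zero_in_R)
      next
        case (Suc l)
        show ?thesis
        proof (rule that)
          show "(contract (Suc m) 2 ^^ i) h = glue m (?X c +
              ext_scale (of_nat (Suc l)) (?D1 ((?D2 ^^ l) d))) (?X d)"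
            unfolding Suc cd(3) contract_pow_glue[OF cd(1,2)] ..
          show "?D1 (ext_scale (of_nat (Suc l)) (?D1 ((?D2 ^^ l) d))) = 0"
            unfolding contract_scale contract_1_1[OF contract_pow_in_R[OF cd(2)]] by simp
        qed (simp add: scale_in_R)
      qed
      have D1h: "contract (Suc m) 1 ((contract (Suc m) 2 ^^ i) h) =
          glue m (?D1 (?X c) + ?X d) (- ?D1 (?X d))"
        unfolding w(3) contract_glue_1[OF XR[OF cd(2)]] by (simp only: contract_add w(2) add_0_right)
      have "glue (Suc m) ((contract (Suc m) 2 ^^ Suc i) g +
          ext_scale s (contract (Suc m) 1 ((contract (Suc m) 2 ^^ i) h)))
          ((contract (Suc m) 2 ^^ Suc i) h) = 0"
        using less.prems(3) contract_pow_glue[OF gh(1,2), of i] by (simp only: 2 gh(3) j s_def)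
      then have 0: "(contract (Suc m) 2 ^^ Suc i) g +
          ext_scale s (contract (Suc m) 1 ((contract (Suc m) 2 ^^ i) h)) = 0"
          "(contract (Suc m) 2 ^^ Suc i) h = 0"
        by (subst (asm) glue_eq_0_iff; simp add: add_in_R scale_in_R)+
      \<comment> \<open>From here the vanishing of the power of D_2 on \<open>f\<close> is split
        into four coordinates: \<open>e1\<close>, \<open>e2\<close> without the last variable,
        \<open>e3\<close>, \<open>e4\<close> with it.\<close>
      have "glue m (?Y a + ext_scale s (?D1 (?X b)) + ext_scale s (?D1 (?X c) + ?X d))
          (?Y b - ext_scale s (?D1 (?X d))) = 0"
        using 0(1) unfolding ab(3) contract_pow_glue[OF ab(1,2)] D1h
        by (simp add: glue_scale glue_add s_def)
      then have e1: "?Y a + ext_scale s (?D1 (?X b)) + ext_scale s (?D1 (?X c) + ?X d) = 0"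
        and e2: "?Y b = ext_scale s (?D1 (?X d))"
        using XR cd(2)
        by (subst (asm) glue_eq_0_iff; simp add: add_in_R scale_in_R uminus_in_R
            add_in_R[OF _ uminus_in_R, unfolded add_uminus_conv_diff])+
      have "glue m (?Y c + ext_scale s (?D1 (?X d))) (?Y d) = 0"
        using 0(2) unfolding cd(3) contract_pow_glue[OF cd(1,2)] s_def .
      then have e3: "?Y c + ext_scale s (?D1 (?X d)) = 0" and e4: "?Y d = 0"
        by (subst (asm) glue_eq_0_iff; simp add: add_in_R scale_in_R)+
      have D1_11: "?D1 (ext_scale s (?D1 (?X u))) = 0" if "u \<in> carrier (R m)" for u
        using contract_1_1[OF XR[OF that]] by (simp add: contract_scale)
      have Y1: "?D2 (?D1 (?X u)) = ?D1 (?Y u)" if "u \<in> carrier (R m)" for u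
        using contract_2_1[OF XR[OF that]] by simp
      \<comment> \<open>By \<open>e2\<close>, \<open>e3\<close> and D_1 D_1 = 0, both
        \<open>?Y b\<close> and \<open>?Y c\<close> are killed by D_1. With \<open>e4\<close>,
        applying D_2 to \<open>e1\<close> then leaves a pure power of D_2 on
        \<open>a\<close>.\<close>
      have "?D1 (?Y b) = 0" unfolding e2 using D1_11[OF cd(2)] .
      moreover have "?D1 (?Y c) = 0"
      proof -
        have "?Y c = - ext_scale s (?D1 (?X d))" using e3 by (rule eq_neg_iff_add_eq_0[THEN iffD2])
        then show ?thesis using D1_11[OF cd(2)] by (simp only: contract_uminus) simp
      qed
      moreover have "?D2 (?Y a) + ext_scale s (?D1 (?Y b)) + ext_scale s (?D1 (?Y c) + ?Y d) = 0"
        using arg_cong[OF e1, of ?D2] Y1[OF ab(2)] Y1[OF cd(1)]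
        by (simp add: contract_add contract_scale)
      ultimately have "(?D2 ^^ Suc (Suc i)) a = 0" by (simp add: e4[simplified])
      \<comment> \<open>The larger power is compensated by the lost variables:
        \<open>m + 2 * (i + 2)\<close> equals \<open>n + 2 * j\<close>.\<close>
      then have a: "a = 0"
        using less.IH[of m "Suc (Suc i)" k a] deg(1) less.prems(1) by (simp add: 2 j)
      then have Ya: "?Y a = 0" by (induction i) auto
      \<comment> \<open>With \<open>a = 0\<close>, D_1 applied to \<open>e1\<close> leaves just the
        term in \<open>d\<close> that separates \<open>?Y b\<close> and \<open>?Y c\<close> from 0
        in \<open>e2\<close> and \<open>e3\<close>.\<close>
      have "ext_scale s (?D1 (?X d)) = 0"
        using arg_cong[OF e1, of ?D1] contract_1_1[OF XR[OF ab(2)]] contract_1_1[OF XR[OF cd(1)]]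
        by (simp add: Ya[simplified] contract_add contract_scale ext.scale_right_distrib)
      then have "?Y b = 0" "?Y c = 0" using e2 e3 by (simp_all only: add_0_right)
      then have bc: "b = 0" "c = 0"
        using less.IH[of m "Suc i" "Suc k'"] deg(2,3) less.prems(1) by (simp_all add: 2 j k)
      then have "?X b = 0" "?X c = 0" by (induction i) auto
      \<comment> \<open>\<open>e1\<close> has shrunk to \<open>s\<close> times \<open>?X d\<close>,
        and \<open>s\<close> is nonzero in characteristic 0.\<close>
      then have "?X d = 0" using e1 s by (simp add: Ya[simplified])
      then have "d = 0"
        using less.IH[of m i k' d] deg(4) less.prems(1) by (simp add: 2 j k)
      then show ?thesis by (simp add: gh(3) ab(3) cd(3) a bc glue_zero)
    qed
  qed
qed

section \<open>Two-row standard tableaux\<close>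

text \<open>Deleting the largest entry is a bijection: \<open>c\<close> ends its row and its column,
  so placing the maximum there preserves both monotonicity conditions.\<close>

lemma card_SYT_max_at_corner:
  assumes cells: "cells sh = insert c (cells sh')" "c \<notin> cells sh'"
    and size: "sum_list sh = Suc (sum_list sh')"
    and corner: "\<And>d. d \<in> cells sh' \<Longrightarrow> fst d = fst c \<Longrightarrow> snd d < snd c"
      "\<And>d. d \<in> cells sh' \<Longrightarrow> snd d = snd c \<Longrightarrow> fst d < fst c"
  shows "card {T \<in> SYT sh. T c = sum_list sh} = num_SYT sh'"
  unfolding num_SYT_def
proof (rule bij_betw_same_card[of "\<lambda>T. restrict T (cells sh')"],
    rule bij_betw_byWitness[where f' = "\<lambda>T. T(c := sum_list sh)"])
  let ?N = "sum_list sh"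
  show "\<forall>T\<in>{T \<in> SYT sh. T c = ?N}. (restrict T (cells sh'))(c := ?N) = T"
    by (auto simp: SYT_def cells(1) fun_eq_iff restrict_def extensional_def)
  show "\<forall>T\<in>SYT sh'. restrict (T(c := ?N)) (cells sh') = T"
    using cells(2) by (auto simp: SYT_def fun_eq_iff restrict_def extensional_def)
  have range: "{1..?N} = insert ?N {1..sum_list sh'}" "?N \<notin> {1..sum_list sh'}"
    using size by auto
  show "(\<lambda>T. restrict T (cells sh')) ` {T \<in> SYT sh. T c = ?N} \<subseteq> SYT sh'"
  proof (intro image_subsetI)
    fix T assume "T \<in> {T \<in> SYT sh. T c = ?N}"
    then have T: "T \<in> SYT sh" "T c = ?N" by auto
    then have "bij_betw T (insert c (cells sh')) (insert ?N {1..sum_list sh'})"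
      by (simp only: SYT_def cells(1) range(1)) blast
    then have "bij_betw T (cells sh') {1..sum_list sh'}"
      using notIn_Un_bij_betw3[of c "cells sh'" T "{1..sum_list sh'}"] T(2) cells(2) range(2) by simp
    then have "bij_betw (restrict T (cells sh')) (cells sh') {1..sum_list sh'}"
      by (rule bij_betw_cong[THEN iffD1, rotated]) simp
    then show "restrict T (cells sh') \<in> SYT sh'"
      using T(1) unfolding SYT_def cells(1) by auto
  qed
  show "(\<lambda>T. T(c := ?N)) ` SYT sh' \<subseteq> {T \<in> SYT sh. T c = ?N}"
  proof (intro image_subsetI)
    fix T assume T: "T \<in> SYT sh'"
    let ?T = "T(c := ?N)"
    have bij: "bij_betw T (cells sh') {1..sum_list sh'}" using T by (simp add: SYT_def)
    then have small: "T d < ?N" if "d \<in> cells sh'" for d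
      using bij_betwE[OF bij] that size by fastforce
    have "bij_betw ?T (cells sh') {1..sum_list sh'}"
      using bij by (rule bij_betw_cong[THEN iffD1, rotated]) (use cells(2) in auto)
    then have "bij_betw ?T (insert c (cells sh')) (insert ?N {1..sum_list sh'})"
      using notIn_Un_bij_betw3[of c "cells sh'" ?T "{1..sum_list sh'}"] cells(2) range(2) by simp
    then have bij': "bij_betw ?T (cells sh) {1..?N}"
      by (simp only: cells(1) range(1))
    have rows: "?T (i, j) < ?T (i, j')"
      if "(i, j) \<in> cells sh" "(i, j') \<in> cells sh" "j < j'" for i j j'
    proof -
      \<comment> \<open>If \<open>(i, j)\<close> were \<open>c\<close>, then \<open>(i, j')\<close>
        would lie in \<open>sh'\<close> to the right of \<open>c\<close>, against
        \<open>corner\<close>.\<close>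
      have "(i, j) \<in> cells sh'"
        using that corner(1)[of "(i, j')"] by (auto simp: cells(1))
      then show ?thesis
        using that T cells small by (auto simp: SYT_def)
    qed
    have cols: "?T (i, j) < ?T (i', j)"
      if "(i, j) \<in> cells sh" "(i', j) \<in> cells sh" "i < i'" for i i' j
    proof -
      have "(i, j) \<in> cells sh'"
        using that corner(2)[of "(i', j)"] by (auto simp: cells(1))
      then show ?thesis
        using that T cells small by (auto simp: SYT_def)
    qed
    have "?T \<in> extensional (cells sh)"
      using T by (auto simp: SYT_def cells(1) extensional_def)
    then show "?T \<in> {T \<in> SYT sh. T c = ?N}"
      using bij' rows cols by (auto simp: SYT_def)
  qed
qed

lemma cells_two_rows: "cells [a, b] = {0} \<times> {..<a} \<union> {1} \<times> {..<b}"
  by (auto simp: cells_def less_Suc_eq nth_Cons split: nat.splits)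

lemma finite_SYT: "finite (SYT sh)"
proof (rule finite_subset)
  have "cells sh = Sigma {..<length sh} (\<lambda>i. {..<sh ! i})"
    by (auto simp: cells_def)
  then show "finite (cells sh \<rightarrow>\<^sub>E {1..sum_list sh})"
    by (intro finite_PiE) auto
  show "SYT sh \<subseteq> cells sh \<rightarrow>\<^sub>E {1..sum_list sh}"
    by (auto simp: SYT_def PiE_def Pi_def bij_betw_def)
qed

lemma num_SYT_empty: "num_SYT [0, 0] = 1"
proof -
  have "cells [0, 0] = {}" by (simp add: cells_two_rows)
  then have "SYT [0, 0] = {\<lambda>_. undefined}"
    by (auto simp: SYT_def bij_betw_def)
  then show ?thesis by (simp add: num_SYT_def)
qed

text \<open>The largest entry has neither a right nor a lower neighbour, so it ends a row; for
  \<open>a = b\<close> the end of the first row has a cell below it.\<close>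

lemma SYT_max_position:
  assumes T: "T \<in> SYT [a, b]" and "b \<le> a" "0 < a"
  shows "b < a \<and> T (0, a - 1) = a + b \<or> 0 < b \<and> T (1, b - 1) = a + b"
proof -
  have bij: "bij_betw T (cells [a, b]) {1..a + b}"
    and rows: "\<And>i j j'. (i, j) \<in> cells [a, b] \<Longrightarrow> (i, j') \<in> cells [a, b] \<Longrightarrow> j < j' \<Longrightarrow> T (i, j) < T (i, j')"
    and cols: "\<And>i i' j. (i, j) \<in> cells [a, b] \<Longrightarrow> (i', j) \<in> cells [a, b] \<Longrightarrow> i < i' \<Longrightarrow> T (i, j) < T (i', j)"
    using T unfolding SYT_def by (auto simp del: One_nat_def) 
  have le: "T d \<le> a + b" if "d \<in> cells [a, b]" for d
    using that bij by (auto simp: bij_betw_def)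
  have "a + b \<in> T ` cells [a, b]"
    using bij assms by (auto simp: bij_betw_def)
  then obtain i j where ij: "(i, j) \<in> cells [a, b]" "T (i, j) = a + b" by force
  have nxt: "(i, Suc j) \<notin> cells [a, b]" "(Suc i, j) \<notin> cells [a, b]"
    using rows[OF ij(1), of "Suc j"] cols[OF ij(1), of "Suc i"] ij(2) le by force+
  show ?thesis
    using ij nxt assms(2) by (auto simp: cells_two_rows not_less le_Suc_eq less_Suc_eq_le)
qed

lemma num_SYT_one_row: "num_SYT [Suc a, 0] = num_SYT [a, 0]"
proof -
  have "card {T \<in> SYT [Suc a, 0]. T (0, a) = sum_list [Suc a, 0]} = num_SYT [a, 0]"
    by (rule card_SYT_max_at_corner) (auto simp: cells_two_rows)
  moreover have "{T \<in> SYT [Suc a, 0]. T (0, a) = sum_list [Suc a, 0]} = SYT [Suc a, 0]"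
    using SYT_max_position[of _ "Suc a" 0] by auto
  ultimately show ?thesis by (simp add: num_SYT_def)
qed

lemma num_SYT_square: "num_SYT [Suc a, Suc a] = num_SYT [Suc a, a]"
proof -
  have "card {T \<in> SYT [Suc a, Suc a]. T (1, a) = sum_list [Suc a, Suc a]} = num_SYT [Suc a, a]"
    by (rule card_SYT_max_at_corner) (auto simp: cells_two_rows)
  moreover have "{T \<in> SYT [Suc a, Suc a]. T (1, a) = sum_list [Suc a, Suc a]} = SYT [Suc a, Suc a]"
    using SYT_max_position[of _ "Suc a" "Suc a"] by auto
  ultimately show ?thesis by (simp add: num_SYT_def)
qed

text \<open>For \<open>b < a\<close> both row ends are removable, and injectivity puts the largest
  entry at exactly one of them.\<close>

lemma num_SYT_two_rows:
  assumes "b < a"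
  shows "num_SYT [Suc a, Suc b] = num_SYT [a, Suc b] + num_SYT [Suc a, b]"
proof -
  let ?sh = "[Suc a, Suc b]"
  let ?X = "{T \<in> SYT ?sh. T (0, a) = sum_list ?sh}"
  let ?Y = "{T \<in> SYT ?sh. T (1, b) = sum_list ?sh}"
  have "card ?X = num_SYT [a, Suc b]"
    by (rule card_SYT_max_at_corner) (use assms in \<open>auto simp: cells_two_rows\<close>)
  moreover have "card ?Y = num_SYT [Suc a, b]"
    by (rule card_SYT_max_at_corner) (auto simp: cells_two_rows)
  moreover have "SYT ?sh = ?X \<union> ?Y"
    using SYT_max_position[of _ "Suc a" "Suc b"] assms by auto
  moreover have "?X \<inter> ?Y = {}"
  proof -
    have "T (0, a) \<noteq> T (1, b)" if "T \<in> SYT ?sh" for T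
    proof -
      have "inj_on T (cells ?sh)" using that by (simp add: SYT_def bij_betw_def)
      then show ?thesis by (auto simp: inj_on_def cells_two_rows)
    qed
    then show ?thesis by (metis (mono_tags, lifting) Int_emptyI mem_Collect_eq)
  qed
  ultimately show ?thesis
    unfolding num_SYT_def using card_Un_disjoint[of ?X ?Y] finite_SYT by simp
qed

text \<open>The ballot numbers. They are integers because the difference can be negative past the
  middle; the case distinction avoids truncating \<open>k - 1\<close> at
  \<open>k = 0\<close>.\<close>

definition ballot :: "nat \<Rightarrow> nat \<Rightarrow> int"
  where "ballot n k = int (n choose k) - (case k of 0 \<Rightarrow> 0 | Suc j \<Rightarrow> int (n choose j))"

lemma ballot_0 [simp]: "ballot n 0 = 1"
  by (simp add: ballot_def)

lemma ballot_Suc: "ballot (Suc n) (Suc k) = ballot n (Suc k) + ballot n k"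
  by (simp add: ballot_def split: nat.split)

text \<open>By symmetry of the binomial coefficients. This is the boundary value of the Pascal
  recursion for tableaux and harmonics alike.\<close>

lemma ballot_middle: "ballot (2 * k + 1) (Suc k) = 0"
  using binomial_symmetric[of k "2 * k + 1"] by (simp add: ballot_def)

lemma num_SYT_eq_ballot: "b \<le> a \<Longrightarrow> int (num_SYT [a, b]) = ballot (a + b) b"
proof (induction "a + b" arbitrary: a b)
  case 0
  then show ?case by (simp add: num_SYT_empty)
next
  case (Suc m)
  then obtain a' where a: "a = Suc a'" by (cases a) auto
  show ?case
  proof (cases b)
    case 0
    then show ?thesis using Suc.hyps(1)[of a' 0] Suc.hyps(2) by (simp add: a num_SYT_one_row)
  next
    case b: (Suc b')
    have *: "int (num_SYT [Suc a', b']) = ballot (Suc a' + b') b'"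
      using Suc.hyps(1)[of "Suc a'" b'] Suc.hyps(2) Suc.prems by (simp add: a b)
    show ?thesis
    proof (cases "b' < a'")
      case True
      then have "int (num_SYT [a', Suc b']) = ballot (a' + Suc b') (Suc b')"
        using Suc.hyps(1)[of a' "Suc b'"] Suc.hyps(2) by (simp add: a b)
      then show ?thesis using * True by (simp add: a b num_SYT_two_rows ballot_Suc)
    next
      case False
      \<comment> \<open>In a rectangle only the end of the second row is removable; the missing
        Pascal term is the zero boundary value.\<close>
      then have "b' = a'" using Suc.prems by (simp add: a b)
      then show ?thesis
        using * ballot_middle[of a'] ballot_Suc[of "2 * a' + 1" a']
        by (simp add: a b num_SYT_square mult_2)
    qed
  qed
qed

section \<open>Dimensions of the harmonics\<close>

lemma contract_in_R_deg:
  assumes "f \<in> R_deg n (k + r)"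
  shows "contract n r f \<in> R_deg n k"
  unfolding mem_R_deg
proof (intro allI impI)
  fix B assume B: "contract n r f B \<noteq> 0"
  then have sub: "B \<subseteq> {1..n}" unfolding contract_def by presburger
  obtain A where A: "A \<subseteq> {1..n} - B" "card A = r" "f (B \<union> A) \<noteq> 0"
    using B sum.not_neutral_contains_not_neutral[of _ "{A. A \<subseteq> {1..n} - B \<and> card A = r}"]
    unfolding contract_def by (force split: if_splits)
  have "card (B \<union> A) = card B + card A"
    by (rule card_Un_disjoint) (use sub A in \<open>auto dest: finite_subset\<close>)
  then show "B \<subseteq> {1..n} \<and> card B = k"
    using assms sub A by (auto simp: mem_R_deg)
qed

text \<open>Covers the degrees below \<open>r\<close>, which the form \<open>k + r\<close> in
  \<open>contract_in_R_deg\<close> cannot express.\<close>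

lemma contract_low_degree:
  assumes "f \<in> R_deg n k" "k < r"
  shows "contract n r f = 0"
proof (rule ext)
  fix B
  have "f (B \<union> A) = 0" if "A \<subseteq> {1..n} - B" "card A = r" for A
  proof (rule ccontr)
    assume "f (B \<union> A) \<noteq> 0"
    then have "B \<union> A \<subseteq> {1..n}" "card (B \<union> A) = k" using assms(1) by (auto simp: mem_R_deg)
    then show False using card_mono[of "B \<union> A" A] that(2) assms(2) finite_subset[of "B \<union> A" "{1..n}"] by simp
  qed
  then show "contract n r f B = 0 B"
    by (auto simp: contract_def zero_fun_apply)
qed

text \<open>For \<open>n \<ge> 1\<close> this is the degree \<open>k\<close> part of
  \<open>EQH n\<close> (\<open>EQH_R_deg\<close>); the contractions of higher index then vanish by
  \<open>contract_vanishes\<close>.\<close>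

definition harmonics :: "nat \<Rightarrow> nat \<Rightarrow> ext set"
  where "harmonics n k = {f \<in> R_deg n k. contract n 1 f = 0 \<and> contract n 2 f = 0}"

lemma subspace_kernel:
  assumes "ext.subspace V" "Vector_Spaces.linear ext_scale ext_scale T"
  shows "ext.subspace {f \<in> V. T f = 0}"
proof -
  interpret Vector_Spaces.linear ext_scale ext_scale T by (rule assms(2))
  show ?thesis using ext.subspace_inter[OF assms(1) subspace_kernel] by (simp add: Int_def)
qed

lemma subspace_harmonics: "ext.subspace (harmonics n k)"
proof -
  have "harmonics n k = {f \<in> {f \<in> R_deg n k. contract n 1 f = 0}. contract n 2 f = 0}"
    by (auto simp: harmonics_def)
  then show ?thesis
    by (simp only: subspace_kernel subspace_R_deg linear_contract)
qed

lemma dim_mono_in_R_deg: "V \<subseteq> W \<Longrightarrow> W \<subseteq> R_deg n k \<Longrightarrow> ext.dim V \<le> ext.dim W"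
  using ext.dim_mono_finite[of V W "mono_basis n k"] R_deg_subset_span[of n k] by simp

lemma dim_subset_0: "V \<subseteq> {0} \<Longrightarrow> ext.dim V = 0"
  using ext.dim_le_card[of V "{}"] by simp

text \<open>The remaining conditions, that D_1 and D_2 kill \<open>h\<close>, follow from D_1 D_1 =
  0 and the commutation of D_1 with D_2.\<close>

lemma glue_in_harmonics:
  assumes "g \<in> carrier (R n)" "h \<in> carrier (R n)"
  shows "glue n g h \<in> harmonics (Suc n) k \<longleftrightarrow>
    g \<in> R_deg n k \<and> contract n 2 g = 0 \<and> h = - contract n 1 g"
proof
  assume H: "glue n g h \<in> harmonics (Suc n) k"
  have "glue n (contract n 1 g + h) (- contract n 1 h) = 0"
    using H unfolding harmonics_def contract_glue_1[OF assms(2), symmetric] by simp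
  then have 1: "contract n 1 g + h = 0" "contract n 1 h = 0"
    by (subst (asm) glue_eq_0_iff; simp add: add_in_R uminus_in_R assms)+
  have "glue n (contract n 2 g + contract n 1 h) (contract n 2 h) = 0"
    using H unfolding harmonics_def contract_glue_2[symmetric] by simp
  then have 2: "contract n 2 g + contract n 1 h = 0"
    by (subst (asm) glue_eq_0_iff; simp add: add_in_R assms)
  show "g \<in> R_deg n k \<and> contract n 2 g = 0 \<and> h = - contract n 1 g"
    using H 1 2 glue_in_R_deg[OF assms, of k]
    by (simp add: harmonics_def add_eq_0_iff)
next
  assume H: "g \<in> R_deg n k \<and> contract n 2 g = 0 \<and> h = - contract n 1 g"
  have h1: "contract n 1 h = 0"
    using H contract_1_1[OF assms(1)] by (simp add: contract_uminus)
  have h2: "contract n 2 h = 0"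
    using H contract_2_1[OF assms(1)] by (simp add: contract_uminus)
  have "glue n g h \<in> R_deg (Suc n) k"
  proof (cases k)
    case 0
    then have "contract n 1 g = 0" using H contract_low_degree[of g n 0 1] by simp
    then show ?thesis using H glue_in_R_deg[OF assms, of k] by (simp add: 0)
  next
    case (Suc j)
    then have "contract n 1 g \<in> R_deg n j" using H contract_in_R_deg[of g n j 1] by simp
    then have "h \<in> R_deg n j" using H subspace_R_deg ext.subspace_neg by blast
    then show ?thesis using H glue_in_R_deg[OF assms, of k] by (simp add: Suc)
  qed
  moreover have "contract (Suc n) 1 (glue n g h) = 0"
    unfolding contract_glue_1[OF assms(2)] using H h1 by (simp add: glue_zero)
  moreover have "contract (Suc n) 2 (glue n g h) = 0"
    unfolding contract_glue_2 using H h1 h2 by (simp add: glue_zero)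
  ultimately show "glue n g h \<in> harmonics (Suc n) k"
    by (simp add: harmonics_def)
qed

text \<open>A harmonic element is determined by its part \<open>g\<close> in one variable fewer, and
  D_2 is injective there: \<open>Suc m < 2 * k\<close> is the bound \<open>m + 2 \<le> 2 * k\<close>
  for the first power.\<close>

lemma harmonics_trivial:
  assumes "n < 2 * k" "f \<in> harmonics n k"
  shows "f = 0"
proof (cases n)
  case 0
  then show ?thesis using assms R_deg_trivial[of n k f] by (simp add: harmonics_def)
next
  case (Suc m)
  obtain g h where gh: "g \<in> carrier (R m)" "h \<in> carrier (R m)" "f = glue m g h"
    using assms(2) R_deg_in_R[of f n k] unfolding Suc harmonics_def by (blast elim: glue_cases)
  then have *: "g \<in> R_deg m k" "contract m 2 g = 0" "h = - contract m 1 g"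
    using assms(2) glue_in_harmonics[OF gh(1,2)] by (simp_all add: Suc)
  then have "g = 0"
    using contract_2_pow_injective[of m 1 k g] assms(1) by (simp add: Suc)
  then show ?thesis using * by (simp add: gh(3) glue_zero)
qed

text \<open>Rank-nullity for the map to the coefficient \<open>h\<close> of the last variable. Its
  kernel has \<open>h = 0\<close>, so \<open>g\<close> itself is harmonic; its image consists of the
  harmonic elements \<open>- contract n 1 g\<close>.\<close>

lemma dim_harmonics_Suc_le:
  "ext.dim (harmonics (Suc n) (Suc k)) \<le> ext.dim (harmonics n (Suc k)) + ext.dim (harmonics n k)"
proof -
  define T :: "ext \<Rightarrow> ext" where "T = (\<lambda>f B. if Suc n \<in> B then 0 else f (insert (Suc n) B))"
  interpret T: Vector_Spaces.linear ext_scale ext_scale T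
    by (rule linear_extI) (auto simp: T_def ext_scale_def fun_eq_iff plus_fun_apply)
  let ?H = "harmonics (Suc n) (Suc k)"
  have T_glue: "T (glue n g h) = h" if "h \<in> carrier (R n)" for g h
    using that by (fastforce simp: T_def glue_def mem_R fun_eq_iff)
  have "ext.dim ?H \<le> ext.dim {f \<in> ?H. T f = 0} + ext.dim (T ` ?H)"
  proof (rule T.dim_le_kernel_image[OF subspace_harmonics])
    show "?H \<subseteq> ext.span (mono_basis (Suc n) (Suc k))"
      using R_deg_subset_span by (auto simp: harmonics_def)
  qed simp
  also have "ext.dim {f \<in> ?H. T f = 0} \<le> ext.dim (harmonics n (Suc k))"
  proof (rule dim_mono_in_R_deg)
    show "{f \<in> ?H. T f = 0} \<subseteq> harmonics n (Suc k)"
    proof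
      fix f assume f: "f \<in> {f \<in> ?H. T f = 0}"
      then obtain g h where gh: "g \<in> carrier (R n)" "h \<in> carrier (R n)" "f = glue n g h"
        using R_deg_in_R[of f] unfolding harmonics_def by (blast elim: glue_cases)
      then have "h = 0" "f = g" using f T_glue[of h g] by (simp_all add: glue_zero_right)
      then show "f \<in> harmonics n (Suc k)"
        using f glue_in_harmonics[OF gh(1,2)] by (simp add: gh(3) harmonics_def)
    qed
  qed (auto simp: harmonics_def)
  also have "ext.dim (T ` ?H) \<le> ext.dim (harmonics n k)"
  proof (rule dim_mono_in_R_deg)
    show "T ` ?H \<subseteq> harmonics n k"
    proof (rule image_subsetI)
      fix f assume f: "f \<in> ?H"
      then obtain g h where gh: "g \<in> carrier (R n)" "h \<in> carrier (R n)" "f = glue n g h"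
        using R_deg_in_R[of f] unfolding harmonics_def by (blast elim: glue_cases)
      have *: "contract n 2 g = 0" "h = - contract n 1 g" "h \<in> R_deg n k"
        using f glue_in_harmonics[OF gh(1,2)] glue_in_R_deg[OF gh(1,2), of "Suc k"]
        by (simp_all add: gh(3) harmonics_def)
      then show "T f \<in> harmonics n k"
        using T_glue[OF gh(2)] contract_1_1[OF gh(1)] contract_2_1[OF gh(1)]
        by (simp add: gh(3) harmonics_def contract_uminus)
    qed
  qed (auto simp: harmonics_def)
  finally show ?thesis by simp
qed

section \<open>Upper and lower bounds for the dimensions\<close>

lemma dim_harmonics_0_le: "ext.dim (harmonics n 0) \<le> 1"
  using dim_mono_in_R_deg[of "harmonics n 0" "R_deg n 0" n 0] dim_R_deg[of n 0]
  by (auto simp: harmonics_def)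

text \<open>The range extends one step past the middle because the recursion keeps the degree while
  losing a variable. At that extra step, \<open>2 * k = Suc n\<close>, both sides are 0.\<close>

lemma dim_harmonics_le: "2 * k \<le> Suc n \<Longrightarrow> int (ext.dim (harmonics n k)) \<le> ballot n k"
proof (induction n arbitrary: k)
  case 0
  then have "k = 0" by simp
  then show ?case using dim_harmonics_0_le[of 0] by simp
next
  case (Suc n)
  show ?case
  proof (cases k)
    case 0
    then show ?thesis using dim_harmonics_0_le by simp
  next
    case k: (Suc j)
    show ?thesis
    proof (cases "2 * k \<le> Suc n")
      case True
      then show ?thesis
        using Suc.IH[of k] Suc.IH[of j] dim_harmonics_Suc_le[of n j] by (simp add: k ballot_Suc)
    next
      case False
      then have n: "Suc n = 2 * j + 1" using Suc.prems k by simp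
      then have "harmonics (Suc n) k \<subseteq> {0}" using harmonics_trivial[of "Suc n" k] k by auto
      then show ?thesis using ballot_middle[of j] dim_subset_0 unfolding n k by simp
    qed
  qed
qed

text \<open>The kernel of D_2 on \<open>n\<close> variables embeds into the harmonics on
  \<open>Suc n\<close> by \<open>?P\<close>, which is injective since it keeps \<open>f\<close> as
  first component.\<close>

lemma dim_harmonics_ge: "ballot (Suc n) k \<le> int (ext.dim (harmonics (Suc n) k))"
proof -
  let ?K = "{f \<in> R_deg n k. contract n 2 f = 0}"
  interpret C: Vector_Spaces.linear ext_scale ext_scale "contract n 2" by (rule linear_contract)
  have rank: "ext.dim (R_deg n k) \<le> ext.dim ?K + ext.dim (contract n 2 ` R_deg n k)"
    by (rule C.dim_le_kernel_image[OF subspace_R_deg R_deg_subset_span]) simp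
  let ?P = "\<lambda>f. glue n f (- contract n 1 f)"
  interpret P: Vector_Spaces.linear ext_scale ext_scale ?P
    by (rule linear_extI) (simp_all add: contract_add contract_scale glue_add glue_scale)
  have "ext.dim ?K \<le> ext.dim {f \<in> ?K. ?P f = 0} + ext.dim (?P ` ?K)"
    by (rule P.dim_le_kernel_image[of _ "mono_basis n k"])
      (use R_deg_subset_span in \<open>auto intro: subspace_kernel subspace_R_deg linear_contract\<close>)
  also have "ext.dim {f \<in> ?K. ?P f = 0} = 0"
    by (rule dim_subset_0) (auto simp: glue_eq_0_iff R_deg_in_R uminus_in_R)
  also have "ext.dim (?P ` ?K) \<le> ext.dim (harmonics (Suc n) k)"
    by (rule dim_mono_in_R_deg[of _ _ "Suc n" k])
      (auto simp: glue_in_harmonics R_deg_in_R uminus_in_R, auto simp: harmonics_def)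
  finally have K: "ext.dim ?K \<le> ext.dim (harmonics (Suc n) k)" by (simp only: add_0)
  show ?thesis
  proof (cases "k < 2")
    case True
    then have "contract n 2 ` R_deg n k \<subseteq> {0}" using contract_low_degree by blast
    then have "n choose k \<le> ext.dim (harmonics (Suc n) k)"
      using rank K dim_subset_0 by (simp add: dim_R_deg)
    moreover have "ballot (Suc n) k = int (n choose k)"
      using True by (cases k) (auto simp: ballot_def less_Suc_eq numeral_2_eq_2)
    ultimately show ?thesis by simp
  next
    case False
    then obtain j where k: "k = j + 2" by (metis add.commute le_Suc_ex not_less)
    have "contract n 2 ` R_deg n k \<subseteq> R_deg n j"
      using contract_in_R_deg unfolding k by blast
    then have "ext.dim (contract n 2 ` R_deg n k) \<le> n choose j"
      using dim_mono_in_R_deg[OF _ order_refl] dim_R_deg by metis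
    then have "n choose k \<le> ext.dim (harmonics (Suc n) k) + (n choose j)"
      using rank K by (simp add: dim_R_deg)
    \<comment> \<open>Pascal's rule on both binomials; the two terms of degree \<open>k - 1\<close>
      cancel.\<close>
    moreover have "ballot (Suc n) k = int (n choose k) - int (n choose j)"
      by (simp add: k ballot_def numeral_2_eq_2)
    ultimately show ?thesis by simp
  qed
qed

lemma dim_harmonics:
  assumes "n \<ge> 1"
  shows "int (ext.dim (harmonics n k)) = (if 2 * k \<le> n then ballot n k else 0)"
proof (cases "2 * k \<le> n")
  case True
  then show ?thesis
    using dim_harmonics_le[of k n] dim_harmonics_ge[of "n - 1" k] assms by simp
next
  case False
  then have "harmonics n k \<subseteq> {0}" using harmonics_trivial[of n k] by auto
  then show ?thesis using False dim_subset_0 by simp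
qed

section \<open>Harmonics as the orthogonal complement of the ideal\<close>

lemma F_apply: "F n r B = (if B \<subseteq> {1..n} \<and> card B = r then 1 else 0)"
proof -
  have "F n r B = (\<Sum>A | A \<subseteq> {1..n} \<and> card A = r. if A = B then 1 else 0)"
    unfolding F_def sum_ext_apply by (intro sum.cong) (auto simp: theta_def)
  then show ?thesis by simp
qed

lemma ext_inner_mult_F: "ext_inner n (ext_mult p (F n r)) q = ext_inner n p (contract n r q)"
proof -
  let ?U = "{1..n}"
  have fin: "finite A" if "A \<subseteq> ?U" for A using that by (rule finite_subset) simp
  have "ext_inner n (ext_mult p (F n r)) q = (\<Sum>C\<in>Pow ?U. \<Sum>A\<in>Pow C.
      (- 1) ^ inversions A (C - A) * p A * F n r (C - A) * q C)"
    by (simp add: ext_inner_eq ext_mult_def sum_distrib_right)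
  also have "\<dots> = (\<Sum>(C, A)\<in>Sigma (Pow ?U) Pow.
      (- 1) ^ inversions A (C - A) * p A * F n r (C - A) * q C)"
    by (subst sum.Sigma) (use fin in auto)
  also have "\<dots> = (\<Sum>(A, B)\<in>Sigma (Pow ?U) (\<lambda>A. Pow (?U - A)).
      (- 1) ^ inversions A B * p A * F n r B * q (A \<union> B))"
  \<comment> \<open>A set \<open>C\<close> with a subset \<open>A\<close> is traded for the disjoint
    pair of \<open>A\<close> and \<open>C - A\<close>.\<close>
  proof (rule sum.reindex_bij_witness[where i = "\<lambda>(A, B). (A \<union> B, A)"
        and j = "\<lambda>(C, A). (A, C - A)"], goal_cases)
    case (5 x)
    then show ?case by (auto simp: Un_absorb1)
  qed auto
  also have "\<dots> = (\<Sum>A\<in>Pow ?U. \<Sum>B\<in>Pow (?U - A).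
      (- 1) ^ inversions A B * p A * F n r B * q (A \<union> B))"
    by (subst sum.Sigma) auto
  also have "\<dots> = (\<Sum>A\<in>Pow ?U. p A * contract n r q A)"
  proof (rule sum.cong)
    fix A assume A: "A \<in> Pow ?U"
    have "(\<Sum>B\<in>Pow (?U - A). (- 1) ^ inversions A B * p A * F n r B * q (A \<union> B)) =
        (\<Sum>B\<in>{B \<in> Pow (?U - A). card B = r}. (- 1) ^ inversions A B * p A * q (A \<union> B))"
      by (rule sum.mono_neutral_cong_right) (auto simp: F_apply)
    also have "{B \<in> Pow (?U - A). card B = r} = {B. B \<subseteq> ?U - A \<and> card B = r}" by auto
    finally show "(\<Sum>B\<in>Pow (?U - A). (- 1) ^ inversions A B * p A * F n r B * q (A \<union> B)) =
        p A * contract n r q A"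
      using A by (simp add: contract_def sum_distrib_left mult_ac)
  qed simp
  finally show ?thesis by (simp add: ext_inner_eq)
qed

text \<open>By disjointness every pair in \<open>A \<times> B\<close> is an inversion in exactly one
  of the two orders.\<close>

lemma inversions_swap:
  assumes "finite A" "finite B" "A \<inter> B = {}"
  shows "inversions A B + inversions B A = card A * card B"
proof -
  have "inversions B A = card {(a, b). a \<in> A \<and> b \<in> B \<and> a < b}"
    unfolding inversions_def by (rule bij_betw_same_card[of prod.swap])
      (auto simp: bij_betw_def inj_on_def image_iff)
  moreover have "card (A \<times> B) =
      card {(a, b). a \<in> A \<and> b \<in> B \<and> b < a} + card {(a, b). a \<in> A \<and> b \<in> B \<and> a < b}"
    (is "_ = card ?X + card ?Y")
  proof -
    have split: "A \<times> B = ?X \<union> ?Y"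
      using assms(3) by (auto simp: neq_iff)
    have "finite ?Y"
      by (rule finite_subset[of _ "A \<times> B"]) (use assms in auto)
    then show ?thesis
      unfolding split by (rule card_Un_disjoint[OF finite_inversions[OF assms(1,2)]]) auto
  qed
  ultimately show ?thesis
    by (simp only: inversions_def card_cartesian_product)
qed

text \<open>Turns a generator on the left into one on the right, where the adjoint is available. The
  sign is applied coordinatewise, so \<open>f\<close> may be inhomogeneous.\<close>

lemma F_graded_commute:
  "ext_mult (F n r) f = ext_mult (\<lambda>A. (- 1) ^ (card A * r) * f A) (F n r)"
proof (rule ext)
  fix C
  show "ext_mult (F n r) f C = ext_mult (\<lambda>A. (- 1) ^ (card A * r) * f A) (F n r) C"
  proof (cases "finite C")
    case True
    have "ext_mult (F n r) f C = (\<Sum>A\<in>Pow C. (- 1) ^ inversions (C - A) A * F n r (C - A) * f A)"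
      unfolding ext_mult_def
      by (rule sum.reindex_bij_witness[where i = "\<lambda>A. C - A" and j = "\<lambda>A. C - A"])
        (auto simp: double_diff)
    also have "\<dots> = ext_mult (\<lambda>A. (- 1) ^ (card A * r) * f A) (F n r) C"
      unfolding ext_mult_def
    proof (rule sum.cong)
      fix A assume "A \<in> Pow C"
      then have "inversions A (C - A) + inversions (C - A) A = card A * card (C - A)"
        using True by (intro inversions_swap) (auto dest: finite_subset)
      then have "(- 1) ^ inversions (C - A) A = (- 1 :: rat) ^ inversions A (C - A) * (- 1) ^ (card A * card (C - A))"
        by (simp add: power_add flip: \<open>_ = card A * card (C - A)\<close>)
      then show "(- 1) ^ inversions (C - A) A * F n r (C - A) * f A =
          (- 1) ^ inversions A (C - A) * ((- 1) ^ (card A * r) * f A) * F n r (C - A)"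
        by (auto simp: F_apply)
    qed simp
    finally show ?thesis .
  qed (simp add: ext_mult_infinite)
qed

text \<open>For \<open>r \<ge> 2\<close>, a nonzero rational multiple of
  \<open>contract n r q\<close> is a contraction of \<open>contract n 2 q\<close>.\<close>

lemma contract_vanishes:
  assumes "q \<in> carrier (R n)" "contract n 1 q = 0" "contract n 2 q = 0" "1 \<le> r"
  shows "contract n r q = 0"
proof (cases "r = 1")
  case False
  then obtain s where s: "r = Suc (Suc s)" using False assms(4) by (cases r; cases "r - 1") auto
  have "ext_scale (of_nat (Suc (s div 2))) (contract n r q) = 0"
    using contract_contract_2[OF assms(1), of s] unfolding s assms(3) contract_zero by (rule sym)
  then show ?thesis
    unfolding ext.scale_eq_0_iff of_nat_eq_0_iff by blast
qed (use assms in simp)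

section \<open>Orthogonality to the whole ideal\<close>

lemma ext_mult_uminus_left: "ext_mult (- f) g = - ext_mult f g"
  and ext_mult_uminus_right: "ext_mult f (- g) = - ext_mult f g"
  by (auto simp: ext_mult_def fun_eq_iff sum_negf uminus_apply)

lemma ext_inner_add_left: "ext_inner n (f + g) q = ext_inner n f q + ext_inner n g q"
  and ext_inner_uminus_left: "ext_inner n (- f) q = - ext_inner n f q"
  by (auto simp: ext_inner_eq sum.distrib sum_negf algebra_simps plus_fun_apply uminus_apply)

text \<open>In a product x F_r y the generator moves to the right end at the cost of signs; by
  adjointness the inner product then contains D_r q = 0.\<close>

lemma ext_inner_ideal:
  assumes q: "q \<in> carrier (R n)" "contract n 1 q = 0" "contract n 2 q = 0" and p: "p \<in> I n"
  shows "ext_inner n p q = 0"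
proof -
  interpret ring "R n" by (rule ring_R)
  \<comment> \<open>Quantifying over both factors makes \<open>?J\<close> a two-sided ideal for trivial reasons.\<close>
  let ?J = "{p \<in> carrier (R n). \<forall>x\<in>carrier (R n). \<forall>y\<in>carrier (R n).
    ext_inner n (ext_mult x (ext_mult p y)) q = 0}"
  have "ideal ?J (R n)"
  proof (rule idealI)
    show "subgroup ?J (add_monoid (R n))"
    proof (rule group.subgroupI)
      show "Group.group (add_monoid (R n))" using a_group .
      have "0 \<in> ?J"
        by (auto simp: zero_in_R ext_mult_def ext_inner_eq zero_fun_apply)
      then show "?J \<noteq> {}" by blast
      fix f assume f: "f \<in> ?J"
      have "f \<oplus>\<^bsub>R n\<^esub> - f = \<zero>\<^bsub>R n\<^esub>" by (simp add: R_def)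
      then have "inv\<^bsub>add_monoid (R n)\<^esub> f = - f"
        using f minus_equality[of "- f" f] a_comm uminus_in_R by (simp add: a_inv_def)
      then show "inv\<^bsub>add_monoid (R n)\<^esub> f \<in> ?J"
        using f by (simp add: uminus_in_R ext_mult_uminus_left ext_mult_uminus_right ext_inner_uminus_left)
      fix g assume g: "g \<in> ?J"
      then have "f + g \<in> ?J"
        using f by (simp add: add_in_R ext_mult_add_left ext_mult_add_right ext_inner_add_left)
      then show "f \<otimes>\<^bsub>add_monoid (R n)\<^esub> g \<in> ?J" by (simp add: R_def)
    qed auto
    fix a x assume "a \<in> ?J" "x \<in> carrier (R n)"
    then have "ext_mult x a \<in> ?J" "ext_mult a x \<in> ?J"
      using ext_mult_in_R by (simp_all add: ext_mult_assoc) (metis ext_mult_assoc)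
    then show "x \<otimes>\<^bsub>R n\<^esub> a \<in> ?J" "a \<otimes>\<^bsub>R n\<^esub> x \<in> ?J" by (simp_all add: R_def)
  qed (rule ring_R)
  moreover have "{F n r | r. 1 \<le> r \<and> r \<le> n} \<subseteq> ?J"
  proof (safe intro!: F_in_R)
    fix r :: nat and x y assume r: "1 \<le> r"
    have "ext_mult x (ext_mult (F n r) y) =
        ext_mult (ext_mult x (\<lambda>A. (- 1) ^ (card A * r) * y A)) (F n r)"
      unfolding F_graded_commute[of n r y] ext_mult_assoc ..
    then show "ext_inner n (ext_mult x (ext_mult (F n r) y)) q = 0"
      using contract_vanishes[OF q r] by (simp add: ext_inner_mult_F) (simp add: ext_inner_eq zero_fun_apply)
  qed
  ultimately have "I n \<subseteq> ?J"
    unfolding I_def by (rule genideal_minimal)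
  then have J: "p \<in> ?J" using p by blast
  \<comment> \<open>Taking both outer factors to be the unit recovers \<open>p\<close>
    itself.\<close>
  have "theta {} \<in> carrier (R n)" "p \<in> carrier (R n)" using J by (simp_all add: theta_in_R)
  moreover from this have "ext_inner n (ext_mult (theta {}) (ext_mult p (theta {}))) q = 0" using J by blast
  ultimately show ?thesis by (simp only: ext_mult_one)
qed

text \<open>Testing against the ideal element \<open>ext_mult (theta B) (F n r)\<close> reads off
  the coefficient of \<open>contract n r q\<close> at \<open>B\<close>.\<close>

lemma contract_EQH:
  assumes "q \<in> EQH n" "1 \<le> r" "r \<le> n"
  shows "contract n r q = 0"
proof (rule ext)
  fix B
  show "contract n r q B = 0 B"
  proof (cases "B \<subseteq> {1..n}")
    case True
    interpret ideal "I n" "R n" by (rule ideal_I)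
    have "{F n r | r. 1 \<le> r \<and> r \<le> n} \<subseteq> I n"
      unfolding I_def by (rule ring.genideal_self[OF ring_R]) (use F_in_R in auto)
    then have "F n r \<in> I n" using assms by blast
    then have "ext_mult (theta B) (F n r) \<in> I n"
      using I_l_closed theta_in_R[OF True] by (simp add: R_def)
    then have "ext_inner n (theta B) (contract n r q) = 0"
      using assms(1) by (simp add: EQH_def flip: ext_inner_mult_F)
    moreover have "ext_inner n (theta B) (contract n r q) = contract n r q B"
    proof -
      have "ext_inner n (theta B) (contract n r q) =
          (\<Sum>A\<in>Pow {1..n}. if A = B then contract n r q B else 0)"
        unfolding ext_inner_eq by (intro sum.cong) (auto simp: theta_def)
      then show ?thesis using True by simp
    qed
    ultimately show ?thesis by (simp add: zero_fun_apply)
  qed (simp add: contract_def zero_fun_apply)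
qed

lemma EQH_R_deg:
  assumes "n \<ge> 1"
  shows "EQH n \<inter> R_deg n k = harmonics n k"
proof (intro equalityI subsetI)
  fix q assume q: "q \<in> EQH n \<inter> R_deg n k"
  have "contract n 2 q = 0"
  proof (cases "2 \<le> n")
    case True
    then show ?thesis using contract_EQH[of q n 2] q by simp
  next
    case False
    \<comment> \<open>F_2 is not among the generators here, but every element of degree at least 2
      is 0 and D_2 kills the lower degrees.\<close>
    then have "n = 1" using assms by simp
    then have "k < 2 \<or> q = 0"
      using q R_deg_trivial[of n k q] by auto
    then show ?thesis using q contract_low_degree[of q n k 2] by auto
  qed
  then show "q \<in> harmonics n k"
    using q contract_EQH[of q n 1] assms by (simp add: harmonics_def)
next
  fix q assume q: "q \<in> harmonics n k"
  then have "q \<in> carrier (R n)" using R_deg_in_R unfolding harmonics_def by blast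
  then show "q \<in> EQH n \<inter> R_deg n k"
    using q ext_inner_ideal[of q n] by (auto simp: harmonics_def EQH_def)
qed

theorem corollary4p4:
  fixes n :: nat
  assumes "n \<ge> 1"
  shows "hilbert_series n (EQH n) =
    (\<Sum>k = 0..n div 2. fps_const (int (num_SYT [n - k, k])) * fps_X ^ k)"
proof (rule fps_ext)
  fix m
  have "fps_nth (\<Sum>k = 0..n div 2. fps_const (int (num_SYT [n - k, k])) * fps_X ^ k) m =
      (\<Sum>k = 0..n div 2. if k = m then int (num_SYT [n - m, m]) else 0)"
    unfolding fps_sum_nth by (intro sum.cong) auto
  also have "\<dots> = (if 2 * m \<le> n then int (num_SYT [n - m, m]) else 0)"
    by auto
  also have "\<dots> = (if 2 * m \<le> n then ballot n m else 0)"
    using num_SYT_eq_ballot[of m "n - m"] by simp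
  also have "\<dots> = fps_nth (hilbert_series n (EQH n)) m"
    using dim_harmonics[OF assms, of m] by (simp add: hilbert_series_def EQH_R_deg[OF assms])
  finally show "fps_nth (hilbert_series n (EQH n)) m =
      fps_nth (\<Sum>k = 0..n div 2. fps_const (int (num_SYT [n - k, k])) * fps_X ^ k) m" ..
qed

end
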